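(* Let $k\in\{0,1,2\}$, $A(t)\in M_m(C^1[t_0,+\infty))$ and $B(t)\in M_m(C[t_0,+\infty))$. The system $\ddot{\mathbf x}+A(t)\dot{\mathbf x}+B(t)\mathbf x=0$ is $L_k$-equivalent to some system $\ddot{\xi}+V(t)\dot{\xi}+W(t)\xi=0$ with $V(t)=V^T(t)$ and $W(t)=W^T(t)$ for all $t\ge t_0$ if and only if there exist a symmetric matrix function $S(t)=S^T(t)\in M_m(C^1[t_0,+\infty))$ and a symmetric positive definite matrix $S_0\in M_m(\mathbb R)$ such that, with $$\Lambda(t)=2\int_{t_0}^{t}S(\nu)\,d\nu+S_0,\qquad K(t)=\tfrac14\left(\Lambda(t)A^T(t)-A(t)\Lambda(t)\right),$$ the following conditions hold: (1) there are constants $\mu>0$, $\eta>0$ such that for all $t\in[t_0,+\infty)$ $$\left|2\int_{t_0}^{t}\mathrm{Tr}(S(\nu))\,d\nu+\mathrm{Tr}(S_0)\right|\le\mu^2,\qquad \det\left(2\int_{t_0}^{t}S(\nu)\,d\nu+S_0\right)\ge\eta^2;$$ (2) if $k\ne0$, then for every $i\in\{0,\dots,k-1\}$ $$\sup_{t\in[t_0,+\infty)}\left\|\frac{d^i}{dt^i}K(t)\right\|+\sup_{t\in[t_0,+\infty)}\left\|\frac{d^i}{dt^i}S(t)\right\|<+\infty$$ (for $k=0$ condition (2) is omitted); (3) for all $t\in[t_0,+\infty)$ $$\Lambda(t)M^T(t)=M(t)\Lambda(t),\qquad M(t)=\frac12\frac{d}{dt}A(t)+\frac14A^2(t)-B(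t).$$
   Context: $M_m(C^i[t_0,+\infty))$ is the space of $m\times m$ matrices whose entries are real-valued $C^i$ functions on $[t_0,+\infty)$ ($C=C^0$); $M_m(\mathbb R)$ is the space of real $m\times m$ matrices; $\|\cdot\|$ is a matrix norm. For $k\in\{0,1,2\}$, a matrix $L(t)\in M_m(C^2[t_0,+\infty))$ is an $L_k$-matrix if there is $\eta>0$ with $|\det L(t)|>\eta$ for all $t\in[t_0,+\infty)$ and $\sup_{t\ge t_0}\left\|\frac{d^i}{dt^i}L(t)\right\|<+\infty$ for all $i=0,\dots,k$. The system $\ddot{\mathbf x}+A(t)\dot{\mathbf x}+B(t)\mathbf x=0$ is $L_k$-equivalent to the system $\ddot\xi+V(t)\dot\xi+W(t)\xi=0$ (with $A,B,V,W\in M_m(C[t_0,+\infty))$) if there exists an $L_k$-matrix $L(t)$ such that for all $t\ge t_0$ $$V=L^{-1}(2\dot L+AL),\qquad W=L^{-1}(\ddot L+A\dot L+BL).$$ *)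

theory Defs
  imports "HOL-Analysis.Analysis"
begin

text \<open>Functions on \<open>[t0, \<infinity>)\<close> are total functions on the reals of which only the
  values on \<open>{t0..}\<close> matter; derivatives are taken within \<open>{t0..}\<close>, i.e. one-sided at \<open>t0\<close>.\<close>

definition nderiv :: "real \<Rightarrow> nat \<Rightarrow> (real \<Rightarrow> 'a::real_normed_vector) \<Rightarrow> real \<Rightarrow> 'a" where
  "nderiv t0 i f = ((\<lambda>g t. vector_derivative g (at t within {t0..})) ^^ i) f"

definition C_class :: "nat \<Rightarrow> real \<Rightarrow> (real \<Rightarrow> 'a::real_normed_vector) \<Rightarrow> bool" where
  "C_class i t0 f \<longleftrightarrow>
     (\<forall>j<i. \<forall>t\<ge>t0. nderiv t0 j f differentiable (at t within {t0..})) \<and>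
     (\<forall>j\<le>i. continuous_on {t0..} (nderiv t0 j f))"

text \<open>An arbitrary norm on the space of matrices; submultiplicativity is not required.\<close>

definition is_matrix_norm :: "(real^'m^'m \<Rightarrow> real) \<Rightarrow> bool" where
  "is_matrix_norm N \<longleftrightarrow>
     (\<forall>X. 0 \<le> N X) \<and> (\<forall>X. N X = 0 \<longleftrightarrow> X = 0) \<and>
     (\<forall>c X. N (c *\<^sub>R X) = \<bar>c\<bar> * N X) \<and> (\<forall>X Y. N (X + Y) \<le> N X + N Y)"

definition sup_nderiv :: "(real^'m^'m \<Rightarrow> real) \<Rightarrow> real \<Rightarrow> nat \<Rightarrow> (real \<Rightarrow> real^'m^'m) \<Rightarrow> ereal" where
  "sup_nderiv N t0 i F = (SUP t\<in>{t0..}. ereal (N (nderiv t0 i F t)))"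

definition symmetric_mat :: "real^'m^'m \<Rightarrow> bool" where
  "symmetric_mat X \<longleftrightarrow> X = transpose X"

definition pos_definite_mat :: "real^'m^'m \<Rightarrow> bool" where
  "pos_definite_mat X \<longleftrightarrow> (\<forall>v. v \<noteq> 0 \<longrightarrow> 0 < v \<bullet> (X *v v))"

definition L_matrix :: "(real^'m^'m \<Rightarrow> real) \<Rightarrow> nat \<Rightarrow> real \<Rightarrow> (real \<Rightarrow> real^'m^'m) \<Rightarrow> bool" where
  "L_matrix N k t0 L \<longleftrightarrow>
     C_class 2 t0 L \<and>
     (\<exists>\<eta>>0. \<forall>t\<ge>t0. \<eta> < \<bar>det (L t)\<bar>) \<and>
     (\<forall>i\<le>k. sup_nderiv N t0 i L < \<infinity>)"

text \<open>A pair of coefficient functions \<open>(A, B)\<close> stands for the system \<open>x'' + A x' + B x = 0\<close>.\<close>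

definition L_equivalent ::
  "(real^'m^'m \<Rightarrow> real) \<Rightarrow> nat \<Rightarrow> real \<Rightarrow>
   (real \<Rightarrow> real^'m^'m) \<times> (real \<Rightarrow> real^'m^'m) \<Rightarrow>
   (real \<Rightarrow> real^'m^'m) \<times> (real \<Rightarrow> real^'m^'m) \<Rightarrow> bool" where
  "L_equivalent N k t0 = (\<lambda>(A, B) (V, W).
     \<exists>L. L_matrix N k t0 L \<and>
       (\<forall>t\<ge>t0.
          V t = matrix_inv (L t) ** (2 *\<^sub>R nderiv t0 1 L t + A t ** L t) \<and>
          W t = matrix_inv (L t) ** (nderiv t0 2 L t + A t ** nderiv t0 1 L t + B t ** L t)))"

end

theory Submission
  imports Defs
begin

text \<open>If \<open>L\<close> symmetrizes the system, put \<open>\<Lambda> = L L\<^sup>T\<close>. Symmetry of \<open>V\<close> says that \<open>L' L\<^sup>T\<close> has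
  skew part \<open>K = (\<Lambda> A\<^sup>T - A \<Lambda>) / 4\<close>, while its symmetric part is \<open>S = \<Lambda>' / 2\<close>; hence
  \<open>L' = (S + K) \<Lambda>\<^sup>-\<^sup>1 L\<close>. Given symmetric \<open>V\<close>, symmetry of \<open>W\<close> is equivalent to \<open>\<Lambda> M\<^sup>T = M \<Lambda>\<close>.
  The bounds on \<open>L\<close> correspond to those on the trace and determinant of \<open>\<Lambda>\<close>, because
  \<open>tr \<Lambda> = \<parallel>L\<parallel>\<^sup>2\<close> and \<open>det \<Lambda> = (det L)\<^sup>2\<close>. Conversely, given \<open>S\<close> and \<open>S\<^sub>0\<close>, one solves this linear
  differential equation for \<open>L\<close> with \<open>L(t\<^sub>0) L(t\<^sub>0)\<^sup>T = S\<^sub>0\<close>: both \<open>L L\<^sup>T\<close> and \<open>\<Lambda>\<close> satisfy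
  \<open>X' = G X + X G\<^sup>T\<close> with \<open>G = (S + K) \<Lambda>\<^sup>-\<^sup>1\<close>, so they agree by Gronwall's inequality.\<close>

subsection \<open>Matrix products and inverses\<close>

text \<open>In finite dimension bilinearity already gives boundedness; the interpretation below then
  supplies limit, continuity and derivative rules for \<open>**\<close>.\<close>

lemma bounded_bilinear_matrix_matrix_mult:
  "bounded_bilinear ((**) :: real^'n^'m \<Rightarrow> real^'p^'n \<Rightarrow> real^'p^'m)"
  unfolding bilinear_conv_bounded_bilinear[symmetric]
  by (auto simp: bilinear_def linear_iff matrix_add_ldistrib matrix_matrix_mult_def vec_eq_iff
      sum.distrib sum_distrib_left algebra_simps)

interpretation matrix_mult: bounded_bilinear
  "(**) :: real^'n^'m \<Rightarrow> real^'p^'n \<Rightarrow> real^'p^'m"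
  by (rule bounded_bilinear_matrix_matrix_mult)

lemma bounded_linear_transpose: "bounded_linear (transpose :: real^'n^'m \<Rightarrow> real^'m^'n)"
  unfolding linear_conv_bounded_linear[symmetric]
  by (auto simp: linear_iff transpose_def vec_eq_iff)

lemmas transpose_add = linear_add[OF bounded_linear.linear[OF bounded_linear_transpose]]
lemmas transpose_diff = linear_diff[OF bounded_linear.linear[OF bounded_linear_transpose]]
lemmas transpose_minus = linear_neg[OF bounded_linear.linear[OF bounded_linear_transpose]]

lemma bounded_linear_trace: "bounded_linear (trace :: real^'n^'n \<Rightarrow> real)"
  unfolding linear_conv_bounded_linear[symmetric]
  by (auto simp: linear_iff trace_def sum.distrib sum_distrib_left)

text \<open>A normal form for noncommutative identities: products are distributed and nested to the
  right, scalars pulled out, transposes pushed onto the factors. What remains is additive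
  arithmetic.\<close>

lemmas matrix_expand =
  matrix_mult.add_left matrix_mult.add_right matrix_mult.diff_left matrix_mult.diff_right
  matrix_mult.minus_left matrix_mult.minus_right matrix_mult.scaleR_left matrix_mult.scaleR_right
  transpose_add transpose_diff transpose_minus transpose_scalar matrix_transpose_mul
  matrix_mul_assoc[symmetric]

text \<open>The norm of this type is the Frobenius norm, so a bound on the trace of
  \<open>L ** transpose L\<close> is a bound on \<open>L\<close>.\<close>

lemma trace_mult_transpose: "trace (X ** transpose X) = (norm (X :: real^'n^'m))\<^sup>2"
  unfolding power2_norm_eq_inner
  by (simp add: trace_def matrix_matrix_mult_def transpose_def inner_vec_def)

lemma pos_definite_mat_imp_det_nonzero:
  assumes "pos_definite_mat X" shows "det X \<noteq> 0"
proof -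
  have "x = 0" if "X *v x = 0" for x
    using assms that unfolding pos_definite_mat_def by (metis inner_zero_right less_irrefl)
  then show ?thesis
    using invertible_det_nz[of X] matrix_left_invertible_ker[of X] invertible_left_inverse by blast
qed

section \<open>Inversion: cancellation, continuity and boundedness\<close>

lemma
  fixes X :: "real^'n^'n"
  assumes "det X \<noteq> 0"
  shows matrix_inv_right: "X ** matrix_inv X = mat 1" and matrix_inv_left: "matrix_inv X ** X = mat 1"
proof -
  have "\<exists>Y. X ** Y = mat 1 \<and> Y ** X = mat 1"
    using assms invertible_det_nz[of X] unfolding invertible_def by blast
  from someI_ex[OF this] show "X ** matrix_inv X = mat 1" "matrix_inv X ** X = mat 1"
    unfolding matrix_inv_def by auto
qed

lemma matrix_inv_cancel:
  fixes X :: "real^'n^'n" and Y :: "real^'p^'n"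
  assumes "det X \<noteq> 0"
  shows "X ** (matrix_inv X ** Y) = Y" and "matrix_inv X ** (X ** Y) = Y"
  using assms by (simp_all add: matrix_mul_assoc matrix_inv_right matrix_inv_left)

text \<open>Cramer's rule for the columns of the inverse. Entries become quotients of determinants,
  from which continuity of inversion can be read off.\<close>

lemma matrix_inv_component:
  fixes X :: "real^'n^'n"
  assumes "det X \<noteq> 0"
  shows "matrix_inv X $ k $ l = det (\<chi> i j. if j = k then axis l 1 $ i else X $ i $ j) / det X"
proof -
  have "X *v (matrix_inv X *v axis l 1) = axis l 1"
    by (simp add: matrix_vector_mul_assoc matrix_inv_right[OF assms])
  then have "matrix_inv X *v axis l 1 = (\<chi> k. det (\<chi> i j. if j = k then axis l 1 $ i else X $ i $ j) / det X)"
    by (simp add: cramer[OF assms])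
  then have "(matrix_inv X *v axis l 1) $ k = det (\<chi> i j. if j = k then axis l 1 $ i else X $ i $ j) / det X"
    by simp
  then show ?thesis
    by (simp add: matrix_vector_mul_component inner_axis' inner_axis)
qed

lemma continuous_on_det [continuous_intros]:
  fixes F :: "'a::topological_space \<Rightarrow> real^'n^'n"
  assumes "continuous_on T F"
  shows "continuous_on T (\<lambda>x. det (F x))"
  unfolding det_def by (intro continuous_intros assms)

lemma continuous_on_matrix_inv [continuous_intros]:
  fixes F :: "'a::topological_space \<Rightarrow> real^'n^'n"
  assumes "continuous_on T F" and "\<And>x. x \<in> T \<Longrightarrow> det (F x) \<noteq> 0"
  shows "continuous_on T (\<lambda>x. matrix_inv (F x))"
proof -
  have "continuous_on T (\<lambda>x. det (\<chi> i j. if j = k then axis l 1 $ i else F x $ i $ j) / det (F x))" for k l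
  proof (intro continuous_on_divide continuous_on_det assms continuous_on_vec_lambda)
    show "continuous_on T (\<lambda>x. if j = k then axis l 1 $ i else F x $ i $ j)" for i j
      by (cases "j = k") (simp_all add: assms continuous_on_component)
  qed (use assms in auto)
  then have "continuous_on T (\<lambda>x. \<chi> k l. det (\<chi> i j. if j = k then axis l 1 $ i else F x $ i $ j) / det (F x))"
    by (intro continuous_on_vec_lambda)
  then show ?thesis
    by (rule continuous_on_eq) (simp add: vec_eq_iff matrix_inv_component assms)
qed

text \<open>Matrices of norm at most \<open>r\<close> with determinant at least \<open>e\<close> in
  absolute value form a compact set, on which inversion is continuous.\<close>

lemma bounded_matrix_inv:
  fixes F :: "'a \<Rightarrow> real^'n^'n"
  assumes "bounded (F ` T)" and "e > 0" and "\<And>x. x \<in> T \<Longrightarrow> e \<le> \<bar>det (F x)\<bar>"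
  shows "bounded ((\<lambda>x. matrix_inv (F x)) ` T)"
proof -
  obtain r where r: "\<And>x. x \<in> T \<Longrightarrow> norm (F x) \<le> r"
    using assms(1) by (auto simp: bounded_iff)
  define C where "C = cball 0 r \<inter> {X :: real^'n^'n. e \<le> \<bar>det X\<bar>}"
  have "closed {X :: real^'n^'n. e \<le> \<bar>det X\<bar>}"
    by (intro closed_Collect_le continuous_intros)
  then have "compact C"
    unfolding C_def by (intro compact_Int_closed compact_cball)
  moreover have "continuous_on C matrix_inv"
    using \<open>e > 0\<close> by (intro continuous_intros) (auto simp: C_def)
  ultimately have "bounded (matrix_inv ` C)"
    by (intro compact_imp_bounded compact_continuous_image)
  then show ?thesis
    by (rule bounded_subset) (use assms r in \<open>auto simp: C_def\<close>)
qed

lemma bounded_matrix_mult: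
  fixes F :: "'a \<Rightarrow> real^'n^'m" and G :: "'a \<Rightarrow> real^'p^'n"
  assumes "bounded (F ` T)" and "bounded (G ` T)"
  shows "bounded ((\<lambda>x. F x ** G x) ` T)"
proof -
  obtain a b where ab: "\<And>x. x \<in> T \<Longrightarrow> norm (F x) \<le> a" "\<And>x. x \<in> T \<Longrightarrow> norm (G x) \<le> b"
    using assms by (auto simp: bounded_iff)
  obtain K where K: "K > 0" "\<And>(X::real^'n^'m) (Y::real^'p^'n). norm (X ** Y) \<le> norm X * norm Y * K"
    using matrix_mult.pos_bounded by blast
  have "norm (F x ** G x) \<le> a * b * K" if "x \<in> T" for x
    using ab[OF that] K(1) order_trans[OF norm_ge_zero ab(1)[OF that]]
    by (intro order_trans[OF K(2)] mult_right_mono mult_mono) auto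
  then show ?thesis by (auto simp: bounded_iff)
qed

lemma bounded_transpose:
  fixes F :: "'a \<Rightarrow> real^'n^'m"
  assumes "bounded (F ` T)"
  shows "bounded ((\<lambda>x. transpose (F x)) ` T)"
  using bounded_linear_image[OF assms bounded_linear_transpose] by (simp add: image_image)

section \<open>The derivative of the inverse, by way of difference quotients\<close>

lemma has_vector_derivative_iff_slope:
  "(f has_vector_derivative D) (at t within T) \<longleftrightarrow>
     ((\<lambda>s. (f s - f t) /\<^sub>R (s - t)) \<longlongrightarrow> D) (at t within T)"
proof -
  have "norm ((1 / norm (s - t)) *\<^sub>R (f s - (f t + (s - t) *\<^sub>R D))) = norm ((f s - f t) /\<^sub>R (s - t) - D)"
    if "s \<noteq> t" for s
  proof -
    have "(f s - f t) /\<^sub>R (s - t) - D = (1 / (s - t)) *\<^sub>R (f s - (f t + (s - t) *\<^sub>R D))"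
      using that by (simp add: diff_diff_eq[symmetric] scaleR_diff_right divide_inverse)
    then show ?thesis by simp
  qed
  then have "((\<lambda>s. norm ((1 / norm (s - t)) *\<^sub>R (f s - (f t + (s - t) *\<^sub>R D)))) \<longlongrightarrow> 0) (at t within T) \<longleftrightarrow>
      ((\<lambda>s. norm ((f s - f t) /\<^sub>R (s - t) - D)) \<longlongrightarrow> 0) (at t within T)"
    by (intro tendsto_cong) (auto simp: eventually_at_filter)
  then show ?thesis
    unfolding has_vector_derivative_def has_derivative_within tendsto_norm_zero_iff
    by (simp add: bounded_linear_scaleR_left LIM_zero_iff)
qed

text \<open>Writing \<open>G\<close> for the inverse of \<open>F\<close>, the identity
  \<open>G s ** ((F s - F t) ** G t) = G t - G s\<close> turns slopes of \<open>F\<close> into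
  slopes of \<open>G\<close>; continuity of \<open>G\<close> does the rest.\<close>

lemma has_vector_derivative_matrix_inv:
  fixes F :: "real \<Rightarrow> real^'n^'n"
  assumes F: "(F has_vector_derivative F') (at t within T)"
    and t: "t \<in> T" and cont: "continuous_on T F" and det: "\<And>s. s \<in> T \<Longrightarrow> det (F s) \<noteq> 0"
  shows "((\<lambda>s. matrix_inv (F s)) has_vector_derivative
           - (matrix_inv (F t) ** (F' ** matrix_inv (F t)))) (at t within T)"
proof -
  let ?G = "\<lambda>s. matrix_inv (F s)"
  have "(?G \<longlongrightarrow> ?G t) (at t within T)"
    using continuous_on_matrix_inv[OF cont det] t unfolding continuous_on_def by blast
  with F have "((\<lambda>s. - (?G s ** (((F s - F t) /\<^sub>R (s - t)) ** ?G t))) \<longlongrightarrow>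
      - (?G t ** (F' ** ?G t))) (at t within T)"
    unfolding has_vector_derivative_iff_slope by (intro tendsto_intros matrix_mult.tendsto)
  moreover have "- (?G s ** (((F s - F t) /\<^sub>R (s - t)) ** ?G t)) = (?G s - ?G t) /\<^sub>R (s - t)"
    if "s \<in> T" for s
  proof -
    have "?G s ** ((F s - F t) ** ?G t) = ?G t - ?G s"
      using det[OF that] det[OF t] by (simp add: matrix_expand matrix_inv_cancel matrix_inv_right)
    then show ?thesis
      by (simp add: matrix_mult.scaleR_left matrix_mult.scaleR_right flip: scaleR_minus_right)
  qed
  ultimately show ?thesis
    unfolding has_vector_derivative_iff_slope
    by (elim Lim_transform_eventually) (auto simp: eventually_at_filter)
qed

subsection \<open>Matrix norms and one-sided derivatives\<close>

text \<open>One half of the equivalence of norms: expand \<open>X\<close> in the standard basis and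
  apply the triangle inequality.\<close>

lemma is_matrix_norm_le:
  assumes "is_matrix_norm N"
  obtains C where "C > 0" "\<And>X. N X \<le> C * norm X"
proof -
  have tri: "N (X + Y) \<le> N X + N Y" and sc: "N (c *\<^sub>R X) = \<bar>c\<bar> * N X" and pos: "0 \<le> N X" for X Y c
    using assms by (auto simp: is_matrix_norm_def)
  have "N 0 = 0" using sc[of 0 0] by simp
  have sum_le: "N (\<Sum>x\<in>T. f x) \<le> (\<Sum>x\<in>T. N (f x))" if "finite T" for T and f :: "real^'a^'a \<Rightarrow> real^'a^'a"
    using that by induction (auto simp: \<open>N 0 = 0\<close> intro: order_trans[OF tri])
  \<comment> \<open>The summand 1 makes strict positivity of \<open>C\<close> immediate.\<close>
  define C where "C = (\<Sum>b\<in>Basis. N b) + 1"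
  have "N X \<le> C * norm X" for X
  proof -
    have "N X \<le> (\<Sum>b\<in>Basis. N ((X \<bullet> b) *\<^sub>R b))"
      using sum_le[of Basis "\<lambda>b. (X \<bullet> b) *\<^sub>R b"] by (simp only: euclidean_representation finite_Basis)
    also have "\<dots> \<le> (\<Sum>b\<in>Basis. norm X * N b)"
      by (intro sum_mono) (auto simp: sc pos Basis_le_norm intro!: mult_right_mono)
    also have "\<dots> \<le> C * norm X"
      by (simp add: C_def algebra_simps sum_distrib_left)
    finally show ?thesis .
  qed
  moreover have "C > 0"
    unfolding C_def by (intro add_nonneg_pos sum_nonneg pos) auto
  ultimately show ?thesis using that by blast
qed

text \<open>The other half: \<open>N\<close> is Lipschitz by the upper bound, hence attains a
  minimum on the compact unit sphere. That minimum is positive by definiteness, and homogeneity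
  extends the estimate to all \<open>X\<close>.\<close>

lemma is_matrix_norm_ge:
  assumes "is_matrix_norm N"
  obtains c where "c > 0" "\<And>X. c * norm X \<le> N X"
proof -
  have tri: "N (X + Y) \<le> N X + N Y" and sc: "N (c *\<^sub>R X) = \<bar>c\<bar> * N X" and pos: "0 \<le> N X"
    and zero: "N X = 0 \<longleftrightarrow> X = 0" for X Y c
    using assms by (auto simp: is_matrix_norm_def)
  obtain C where C: "C > 0" "\<And>X. N X \<le> C * norm X"
    using is_matrix_norm_le[OF assms] by blast
  have "\<bar>N X - N Y\<bar> \<le> C * norm (X - Y)" for X Y
    using tri[of "X - Y" Y] tri[of "Y - X" X] C(2)[of "X - Y"] C(2)[of "Y - X"]
    by (simp add: norm_minus_commute abs_le_iff)
  then have "C-lipschitz_on UNIV N"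
    using C(1) by (intro lipschitz_onI) (auto simp: dist_norm)
  then have cont: "continuous_on (sphere 0 1) N"
    using lipschitz_on_continuous_on continuous_on_subset by blast
  have ne: "sphere (0 :: real^'a^'a) 1 \<noteq> {}"
    by simp
  then obtain Z where Z: "Z \<in> sphere 0 1" "\<And>X. X \<in> sphere 0 1 \<Longrightarrow> N Z \<le> N X"
    using continuous_attains_inf[OF compact_sphere ne cont] by blast
  have "N Z * norm X \<le> N X" for X
  proof (cases "X = 0")
    case True
    then show ?thesis using zero[of 0] by simp
  next
    case False
    then have "N Z \<le> N (X /\<^sub>R norm X)"
      by (intro Z) auto
    then show ?thesis
      using False by (simp add: sc field_simps)
  qed
  moreover have "N Z > 0"
    using Z(1) zero[of Z] pos[of Z] by (cases "Z = 0") auto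
  ultimately show ?thesis using that by blast
qed

text \<open>Equivalence of norms removes \<open>N\<close> and the extended reals from all later
  arguments, which speak of boundedness only.\<close>

lemma sup_nderiv_less_infinity_iff:
  assumes "is_matrix_norm N"
  shows "sup_nderiv N t0 i F < \<infinity> \<longleftrightarrow> bounded (nderiv t0 i F ` {t0..})"
proof
  obtain c where c: "c > 0" "\<And>X. c * norm X \<le> N X"
    using is_matrix_norm_ge[OF assms] by blast
  assume "sup_nderiv N t0 i F < \<infinity>"
  then obtain r where r: "sup_nderiv N t0 i F \<le> ereal r"
    by (cases "sup_nderiv N t0 i F") auto
  have "norm (nderiv t0 i F t) \<le> r / c" if "t \<in> {t0..}" for t
  proof -
    have "ereal (N (nderiv t0 i F t)) \<le> ereal r"
      using r that unfolding sup_nderiv_def by (meson SUP_upper order_trans)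
    then show ?thesis
      using c(1) c(2)[of "nderiv t0 i F t"] by (simp add: field_simps)
  qed
  then show "bounded (nderiv t0 i F ` {t0..})"
    by (auto simp: bounded_iff)
next
  obtain C where C: "C > 0" "\<And>X. N X \<le> C * norm X"
    using is_matrix_norm_le[OF assms] by blast
  assume "bounded (nderiv t0 i F ` {t0..})"
  then obtain r where r: "\<And>t. t \<ge> t0 \<Longrightarrow> norm (nderiv t0 i F t) \<le> r"
    by (auto simp: bounded_iff)
  have "sup_nderiv N t0 i F \<le> ereal (C * r)"
    unfolding sup_nderiv_def
  proof (rule SUP_least)
    fix t assume "t \<in> {t0..}"
    then show "ereal (N (nderiv t0 i F t)) \<le> ereal (C * r)"
      using C(1) r[of t] by (auto intro: order_trans[OF C(2)])
  qed
  then show "sup_nderiv N t0 i F < \<infinity>"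
    by auto
qed

section \<open>Iterated one-sided derivatives and the classes \<open>C_class 1\<close> and
  \<open>C_class 2\<close>\<close>

lemma nderiv_0 [simp]: "nderiv t0 0 f = f"
  by (simp add: nderiv_def)

lemma nderiv_Suc: "nderiv t0 (Suc i) f t = vector_derivative (nderiv t0 i f) (at t within {t0..})"
  by (simp add: nderiv_def)

text \<open>Each point of the half-line, \<open>t0\<close> included, is a limit point of it; this
  makes one-sided derivatives unique.\<close>

lemma at_within_atLeast_neq_bot: "t \<ge> t0 \<Longrightarrow> at t within {t0..} \<noteq> bot" for t :: real
  using trivial_limit_within islimpt_subset[of t "{t0..t + 1}" "{t0..}"] islimpt_Icc[of t0 "t + 1" t] by force

lemma nderiv_Suc_eqI:
  assumes "\<And>s. s \<ge> t0 \<Longrightarrow> nderiv t0 i f s = g s" and "t \<ge> t0"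
    and "(g has_vector_derivative d) (at t within {t0..})"
  shows "nderiv t0 (Suc i) f t = d"
proof -
  have "(nderiv t0 i f has_vector_derivative d) (at t within {t0..})"
    using assms by (intro has_vector_derivative_transform[OF _ _ assms(3)]) auto
  then show ?thesis
    unfolding nderiv_Suc using at_within_atLeast_neq_bot[OF assms(2)] vector_derivative_within by blast
qed

lemma nderiv_1_eqI:
  assumes "(f has_vector_derivative d) (at t within {t0..})" and "t \<ge> t0"
  shows "nderiv t0 1 f t = d"
  using nderiv_Suc_eqI[of t0 0 f f t d] assms by simp

lemma nderiv_2_eqI:
  assumes "\<And>s. s \<ge> t0 \<Longrightarrow> (f has_vector_derivative g s) (at s within {t0..})" and "t \<ge> t0"
    and "(g has_vector_derivative d) (at t within {t0..})"
  shows "nderiv t0 2 f t = d"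
  using nderiv_Suc_eqI[of t0 1 f g t d] nderiv_1_eqI[OF assms(1)] assms by (simp add: numeral_2_eq_2)

lemma C_class_0_iff: "C_class 0 t0 f \<longleftrightarrow> continuous_on {t0..} f"
  by (simp add: C_class_def)

lemma C_class_imp_continuous_on: "C_class i t0 f \<Longrightarrow> continuous_on {t0..} f"
  unfolding C_class_def by (metis le0 nderiv_0)

text \<open>Trades \<open>nderiv\<close> for an explicit derivative function, to which the product
  rules apply directly; the analogue for second derivatives follows.\<close>

lemma C_class_1_iff:
  "C_class 1 t0 f \<longleftrightarrow> (\<exists>f'. continuous_on {t0..} f' \<and>
     (\<forall>t\<ge>t0. (f has_vector_derivative f' t) (at t within {t0..})))"
proof
  assume "C_class 1 t0 f"
  then show "\<exists>f'. continuous_on {t0..} f' \<and>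
     (\<forall>t\<ge>t0. (f has_vector_derivative f' t) (at t within {t0..}))"
    by (intro exI[of _ "nderiv t0 1 f"])
      (auto simp: C_class_def nderiv_Suc simp flip: vector_derivative_works)
next
  assume "\<exists>f'. continuous_on {t0..} f' \<and>
     (\<forall>t\<ge>t0. (f has_vector_derivative f' t) (at t within {t0..}))"
  then obtain f' where f': "continuous_on {t0..} f'"
    "\<And>t. t \<ge> t0 \<Longrightarrow> (f has_vector_derivative f' t) (at t within {t0..})"
    by blast
  have "continuous_on {t0..} (nderiv t0 1 f)"
    using f'(1) by (rule continuous_on_eq) (use nderiv_1_eqI[OF f'(2)] in auto)
  moreover have "continuous_on {t0..} f"
    using f'(2) by (auto intro!: continuous_on_vector_derivative)
  ultimately show "C_class 1 t0 f"
    using f'(2) by (auto simp: C_class_def le_Suc_eq intro: differentiableI_vector)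
qed

lemma C_class_2_iff:
  "C_class 2 t0 f \<longleftrightarrow> (\<exists>f' f''. continuous_on {t0..} f'' \<and>
     (\<forall>t\<ge>t0. (f has_vector_derivative f' t) (at t within {t0..})) \<and>
     (\<forall>t\<ge>t0. (f' has_vector_derivative f'' t) (at t within {t0..})))"
proof
  assume "C_class 2 t0 f"
  then show "\<exists>f' f''. continuous_on {t0..} f'' \<and>
     (\<forall>t\<ge>t0. (f has_vector_derivative f' t) (at t within {t0..})) \<and>
     (\<forall>t\<ge>t0. (f' has_vector_derivative f'' t) (at t within {t0..}))"
    by (intro exI[of _ "nderiv t0 1 f"] exI[of _ "nderiv t0 2 f"])
      (auto simp: C_class_def nderiv_Suc numeral_2_eq_2 less_Suc_eq simp flip: vector_derivative_works)
next
  assume "\<exists>f' f''. continuous_on {t0..} f'' \<and>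
     (\<forall>t\<ge>t0. (f has_vector_derivative f' t) (at t within {t0..})) \<and>
     (\<forall>t\<ge>t0. (f' has_vector_derivative f'' t) (at t within {t0..}))"
  then obtain f' f'' where f': "continuous_on {t0..} f''"
    "\<And>t. t \<ge> t0 \<Longrightarrow> (f has_vector_derivative f' t) (at t within {t0..})"
    "\<And>t. t \<ge> t0 \<Longrightarrow> (f' has_vector_derivative f'' t) (at t within {t0..})"
    by blast
  have eq1: "nderiv t0 1 f t = f' t" if "t \<ge> t0" for t
    using nderiv_1_eqI f'(2) that by blast
  have d1: "(nderiv t0 1 f has_vector_derivative f'' t) (at t within {t0..})" if "t \<ge> t0" for t
    using that by (intro has_vector_derivative_transform[OF _ _ f'(3)]) (auto simp: eq1[unfolded One_nat_def])
  have "continuous_on {t0..} (nderiv t0 2 f)"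
    using f'(1) by (rule continuous_on_eq) (use nderiv_2_eqI[OF f'(2) _ f'(3)] in auto)
  moreover have "continuous_on {t0..} f" "continuous_on {t0..} (nderiv t0 1 f)"
    using f'(2) d1 by (auto intro!: continuous_on_vector_derivative)
  ultimately show "C_class 2 t0 f"
    using f'(2) d1 by (auto simp: C_class_def le_Suc_eq less_Suc_eq numeral_2_eq_2 intro: differentiableI_vector)
qed

subsection \<open>Linear differential equations\<close>

text \<open>The induction step in the bound on Picard terms: integration carries one term of the
  exponential series to the next.\<close>

lemma integral_power_fact:
  fixes a t c :: real
  assumes "a \<le> t"
  shows "((\<lambda>s. c * (c * (s - a)) ^ n / fact n) has_integral (c * (t - a)) ^ Suc n / fact (Suc n)) {a..t}"
proof -
  have "((\<lambda>s. c * (c * (s - a)) ^ n / fact n) has_integral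
      (c * (t - a)) ^ Suc n / fact (Suc n) - (c * (a - a)) ^ Suc n / fact (Suc n)) {a..t}"
  proof (rule fundamental_theorem_of_calculus[OF assms])
    fix s assume "s \<in> {a..t}"
    show "((\<lambda>s. (c * (s - a)) ^ Suc n / fact (Suc n)) has_vector_derivative c * (c * (s - a)) ^ n / fact n)
      (at s within {a..t})"
      unfolding has_real_derivative_iff_has_vector_derivative[symmetric]
      by (rule derivative_eq_intros refl | simp)+
  qed
  then show ?thesis by simp
qed

lemma bounded_image_Icc_mult:
  fixes G :: "real \<Rightarrow> 'a::real_normed_vector"
    and pr :: "'a \<Rightarrow> 'b::real_normed_vector \<Rightarrow> 'c::real_normed_vector"
  assumes "bounded_bilinear pr"
    and "continuous_on {a..b} G"
  obtains c where "c > 0" "\<And>s x. s \<in> {a..b} \<Longrightarrow> norm (pr (G s) x) \<le> c * norm x"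
proof -
  interpret bounded_bilinear pr by fact
  have "bounded (G ` {a..b})"
    using assms(2) by (intro compact_imp_bounded compact_continuous_image) auto
  then obtain B where B: "B > 0" "\<And>s. s \<in> {a..b} \<Longrightarrow> norm (G s) \<le> B"
    by (auto simp: bounded_pos)
  obtain K where K: "K > 0" "\<And>x y. norm (pr x y) \<le> norm x * norm y * K"
    using pos_bounded by blast
  have "norm (pr (G s) x) \<le> B * K * norm x" if "s \<in> {a..b}" for s x
  proof -
    have "norm (G s) * (norm x * K) \<le> B * (norm x * K)"
      using B(2)[OF that] K(1) by (intro mult_right_mono) auto
    then show ?thesis using K(2)[of "G s" x] by (simp add: mult_ac)
  qed
  then show ?thesis using that[of "B * K"] B(1) K(1) by simp
qed

text \<open>The differences of consecutive Picard iterates for \<open>x' = G t x\<close> with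
  initial value \<open>x0\<close>; their series is the solution.\<close>

primrec picard_term :: "(real \<Rightarrow> 'a \<Rightarrow> 'a) \<Rightarrow> real \<Rightarrow> 'a \<Rightarrow> nat \<Rightarrow> real \<Rightarrow> 'a::banach" where
  "picard_term G t0 x0 0 = (\<lambda>t. x0)"
| "picard_term G t0 x0 (Suc n) = (\<lambda>t. integral {t0..t} (\<lambda>s. G s (picard_term G t0 x0 n s)))"

text \<open>On each compact interval the Picard series is dominated by an exponential series, so it
  converges uniformly and may be differentiated term by term. The half-line is exhausted by such
  intervals.\<close>

lemma linear_ode_solution:
  fixes G :: "real \<Rightarrow> 'a::real_normed_vector" and pr :: "'a \<Rightarrow> 'b \<Rightarrow> 'b::banach"
  assumes bil: "bounded_bilinear pr" and G: "continuous_on {t0..} G"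
  obtains X where "X t0 = x0"
    "\<And>t. t \<ge> t0 \<Longrightarrow> (X has_vector_derivative pr (G t) (X t)) (at t within {t0..})"
proof -
  interpret bounded_bilinear pr by fact
  define P where "P = picard_term (\<lambda>s. pr (G s)) t0 x0"
  define X where "X t = (\<Sum>n. P n t)" for t
  have P_0: "P 0 t = x0" and P_Suc: "P (Suc n) t = integral {t0..t} (\<lambda>s. pr (G s) (P n s))" for n t
    by (simp_all add: P_def)
  have G': "continuous_on {t0..T} G" for T
    using G by (rule continuous_on_subset) auto
  have cont: "continuous_on {t0..T} (P n)" for n T
  proof (induction n)
    case 0
    then show ?case by (simp add: P_0)
  next
    case (Suc n)
    have "continuous_on {t0..T} (\<lambda>s. pr (G s) (P n s))"
      by (intro continuous_on G' Suc)
    then have "continuous_on {t0..T} (\<lambda>t. integral {t0..t} (\<lambda>s. pr (G s) (P n s)))"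
      by (intro indefinite_integral_continuous_1 integrable_continuous_real)
    then show ?case by (simp add: P_Suc)
  qed
  have dP: "(P (Suc n) has_vector_derivative pr (G t) (P n t)) (at t within {t0..T})"
    if "t \<in> {t0..T}" for n t T
  proof -
    have "continuous_on {t0..T} (\<lambda>s. pr (G s) (P n s))"
      by (intro continuous_on G' cont)
    from integral_has_vector_derivative[OF this that] show ?thesis
      by (simp add: P_Suc[abs_def])
  qed
  have main: "(X has_vector_derivative pr (G t) (X t)) (at t within {t0..T})" and X_t0: "X t0 = x0"
    if t: "t \<in> {t0..T}" for t T
  proof -
    obtain c where c: "c > 0" "\<And>s x. s \<in> {t0..T} \<Longrightarrow> norm (pr (G s) x) \<le> c * norm x"
      using bounded_image_Icc_mult[OF bil G'] by metis
    have bound: "norm (P n s) \<le> norm x0 * ((c * (s - t0)) ^ n / fact n)" if "s \<in> {t0..T}" for n s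
      using that
    proof (induction n arbitrary: s)
      case 0
      then show ?case by (simp add: P_0)
    next
      case (Suc n)
      let ?g = "\<lambda>s. norm x0 * (c * (c * (s - t0)) ^ n / fact n)"
      have hi: "(?g has_integral norm x0 * ((c * (s - t0)) ^ Suc n / fact (Suc n))) {t0..s}"
        using Suc.prems by (intro has_integral_mult_right integral_power_fact) auto
      have "norm (integral {t0..s} (\<lambda>s. pr (G s) (P n s))) \<le> integral {t0..s} ?g"
      proof (rule integral_norm_bound_integral)
        show "(\<lambda>s. pr (G s) (P n s)) integrable_on {t0..s}"
          by (intro integrable_continuous_real continuous_on G' cont)
        show "?g integrable_on {t0..s}" using hi by (rule has_integral_integrable)
        fix r assume "r \<in> {t0..s}"
        then have r: "r \<in> {t0..T}" using Suc.prems by auto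
        have "norm (pr (G r) (P n r)) \<le> c * norm (P n r)" by (rule c(2)[OF r])
        also have "\<dots> \<le> c * (norm x0 * ((c * (r - t0)) ^ n / fact n))"
          using Suc.IH[OF r] c(1) by (intro mult_left_mono) auto
        finally show "norm (pr (G r) (P n r)) \<le> ?g r" by (simp add: mult_ac)
      qed
      then show ?case using hi by (simp only: P_Suc integral_unique)
    qed
    have unif: "uniform_limit {t0..T} (\<lambda>n s. \<Sum>i<n. P i s) X sequentially"
      unfolding X_def
    proof (rule Weierstrass_m_test)
      fix n s assume s: "s \<in> {t0..T}"
      have "norm (P n s) \<le> norm x0 * ((c * (s - t0)) ^ n / fact n)" by (rule bound[OF s])
      also have "\<dots> \<le> norm x0 * ((c * (T - t0)) ^ n / fact n)"
        using s c(1) by (intro mult_left_mono divide_right_mono power_mono) auto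
      finally show "norm (P n s) \<le> norm x0 * ((c * (T - t0)) ^ n / fact n)" .
    next
      show "summable (\<lambda>n. norm x0 * ((c * (T - t0)) ^ n / fact n))"
        using summable_exp[of "c * (T - t0)"] by (intro summable_mult) (simp add: field_simps)
    qed
    have sums: "(\<lambda>n. P n s) sums X s" if "s \<in> {t0..T}" for s
      using tendsto_uniform_limitI[OF unif that] by (simp add: sums_def)
    \<comment> \<open>The series is differentiated without its constant term:
      \<open>P (Suc n)\<close> has derivative \<open>pr (G s) (P n s)\<close>, so the derivatives
      sum to \<open>pr (G s) (X s)\<close> with no shift of index.\<close>
    have "\<exists>g. \<forall>s\<in>{t0..T}. (\<lambda>n. P (Suc n) s) sums g s \<and>
        (g has_derivative (\<lambda>h. h *\<^sub>R pr (G s) (X s))) (at s within {t0..T})"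
    proof (rule has_derivative_series)
      show "convex {t0..T}" by simp
      show "(P (Suc n) has_derivative (\<lambda>h. h *\<^sub>R pr (G s) (P n s))) (at s within {t0..T})"
        if "s \<in> {t0..T}" for n s
        using dP[OF that] unfolding has_vector_derivative_def .
      show "t \<in> {t0..T}" by (rule t)
      show "(\<lambda>n. P (Suc n) t) sums (X t - P 0 t)"
        using sums[OF t] by (subst sums_Suc_iff) simp
      fix e :: real assume "e > 0"
      \<comment> \<open>Applying \<open>pr (G s)\<close> enlarges norms by a factor of at most
        \<open>c\<close>, so the partial sums must be within \<open>e / c\<close> of
        \<open>X\<close>.\<close>
      then have "e / c > 0" using c(1) by simp
      from uniform_limitD[OF unif this]
      show "\<forall>\<^sub>F n in sequentially. \<forall>s\<in>{t0..T}. \<forall>h.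
          norm ((\<Sum>i<n. h *\<^sub>R pr (G s) (P i s)) - h *\<^sub>R pr (G s) (X s)) \<le> e * norm h"
      proof (rule eventually_mono, intro ballI allI)
        fix n s and h :: real assume d: "\<forall>s\<in>{t0..T}. dist (\<Sum>i<n. P i s) (X s) < e / c" and s: "s \<in> {t0..T}"
        have "(\<Sum>i<n. h *\<^sub>R pr (G s) (P i s)) - h *\<^sub>R pr (G s) (X s) =
            h *\<^sub>R pr (G s) ((\<Sum>i<n. P i s) - X s)"
          by (simp add: sum_right diff_right scaleR_right_diff_distrib flip: scaleR_sum_right)
        also have "norm \<dots> \<le> \<bar>h\<bar> * (c * norm ((\<Sum>i<n. P i s) - X s))"
          using c(2)[OF s] by (simp add: mult_left_mono)
        also have "\<dots> \<le> \<bar>h\<bar> * e"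
          using d s c(1) by (intro mult_left_mono) (auto simp: dist_norm field_simps intro: less_imp_le)
        finally show "norm ((\<Sum>i<n. h *\<^sub>R pr (G s) (P i s)) - h *\<^sub>R pr (G s) (X s)) \<le> e * norm h"
          by (simp add: mult.commute)
      qed
    qed
    then obtain g where g: "\<And>s. s \<in> {t0..T} \<Longrightarrow> (\<lambda>n. P (Suc n) s) sums g s"
      "\<And>s. s \<in> {t0..T} \<Longrightarrow> (g has_vector_derivative pr (G s) (X s)) (at s within {t0..T})"
      unfolding has_vector_derivative_def by blast
    have Xg: "X s = g s + x0" if "s \<in> {t0..T}" for s
      using sums_unique2[OF sums[OF that], of "g s + x0"] g(1)[OF that] by (subst (asm) sums_Suc_iff) (simp add: P_0)
    have "((\<lambda>s. g s + x0) has_vector_derivative pr (G t) (X t)) (at t within {t0..T})"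
      using has_vector_derivative_add[OF g(2)[OF t] has_vector_derivative_const] by simp
    from has_vector_derivative_transform[OF t Xg this]
    show "(X has_vector_derivative pr (G t) (X t)) (at t within {t0..T})" .
    have "P n t0 = (if n = 0 then x0 else 0)" for n
      by (cases n) (simp_all add: P_0 P_Suc)
    then have "(\<lambda>n. P n t0) sums x0" using sums_single[of 0 "\<lambda>_. x0"] by (simp add: eq_commute[of 0])
    then show "X t0 = x0" unfolding X_def by (rule sums_unique[symmetric])
  qed
  \<comment> \<open>Differentiability is local: near \<open>t\<close> the half-line and
    \<open>{t0..t + 1}\<close> coincide.\<close>
  have "(X has_vector_derivative pr (G t) (X t)) (at t within {t0..})" if "t \<ge> t0" for t
  proof -
    have "at t within {t0..} = at t within {t0..t + 1}"
      by (rule at_within_nhd[of _ "{t - 1<..<t + 1}"]) auto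
    then show ?thesis using main[of t "t + 1"] that by simp
  qed
  then show ?thesis using that X_t0[of t0 t0] by auto
qed

text \<open>With \<open>C\<close> bounding \<open>c\<close> on \<open>{t0..T}\<close>, the function
  \<open>exp (- 2 * C * t) * (D t \<bullet> D t)\<close> is nonincreasing and nonnegative, and it
  starts at zero. The inner product makes the squared norm differentiable.\<close>

lemma gronwall_zero:
  fixes D :: "real \<Rightarrow> 'a::real_inner"
  assumes D: "\<And>t. t \<ge> t0 \<Longrightarrow> (D has_vector_derivative D' t) (at t within {t0..})"
    and c: "continuous_on {t0..} c" and le: "\<And>t. t \<ge> t0 \<Longrightarrow> norm (D' t) \<le> c t * norm (D t)"
    and "D t0 = 0" and "T \<ge> t0"
  shows "D T = 0"
proof -
  have "bounded (c ` {t0..T})"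
    using c by (intro compact_imp_bounded compact_continuous_image) (auto elim: continuous_on_subset)
  then obtain C where "\<forall>x\<in>c ` {t0..T}. norm x \<le> C"
    by (auto simp: bounded_iff)
  then have C: "c t \<le> C" if "t \<in> {t0..T}" for t
    using that by force
  let ?u = "\<lambda>t. exp (- 2 * C * t) * (D t \<bullet> D t)"
  have "continuous_on {t0..} D"
    using D by (auto intro!: continuous_on_vector_derivative)
  then have "continuous_on {t0..T} D"
    by (rule continuous_on_subset) auto
  then have "continuous_on {t0..T} ?u"
    by (intro continuous_intros)
  moreover have "\<exists>y. DERIV ?u t :> y \<and> y \<le> 0" if "t0 < t" "t < T" for t
  proof -
    have "at t within {t0..} = at t"
      using that by (intro at_within_interior) simp
    then have "(D has_derivative (\<lambda>h. h *\<^sub>R D' t)) (at t)"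
      using D[of t] that by (simp add: has_vector_derivative_def)
    then have "((\<lambda>t. D t \<bullet> D t) has_derivative (\<lambda>h. D t \<bullet> (h *\<^sub>R D' t) + (h *\<^sub>R D' t) \<bullet> D t)) (at t)"
      by (rule has_derivative_inner) fact
    then have dD: "DERIV (\<lambda>t. D t \<bullet> D t) t :> 2 * (D t \<bullet> D' t)"
      by (simp add: has_field_derivative_def inner_commute algebra_simps mult_commute_abs)
    have "DERIV ?u t :> exp (- 2 * C * t) * (2 * (D t \<bullet> D' t) - 2 * C * (D t \<bullet> D t))"
      by (rule dD derivative_eq_intros refl | simp)+ (simp add: algebra_simps)
    moreover have "D t \<bullet> D' t \<le> C * (D t \<bullet> D t)"
    proof -
      have "D t \<bullet> D' t \<le> norm (D t) * norm (D' t)" by (rule norm_cauchy_schwarz)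
      also have "\<dots> \<le> norm (D t) * (C * norm (D t))"
        using le[of t] C[of t] that by (intro mult_left_mono order_trans[OF le[of t]] mult_right_mono) auto
      finally show ?thesis by (simp add: power2_norm_eq_inner[symmetric] power2_eq_square mult_ac)
    qed
    ultimately show ?thesis
      by (intro exI[of _ "exp (- 2 * C * t) * (2 * (D t \<bullet> D' t) - 2 * C * (D t \<bullet> D t))"])
        (auto simp: mult_le_0_iff)
  qed
  ultimately have "?u T \<le> ?u t0"
    using DERIV_nonpos_imp_decreasing_open[OF \<open>T \<ge> t0\<close>, of ?u] by blast
  then have "D T \<bullet> D T \<le> 0"
    using \<open>D t0 = 0\<close> by (simp add: mult_le_0_iff)
  then show ?thesis
    by (metis inner_gt_zero_iff not_le)
qed

subsection \<open>Factoring a path of symmetric matrices\<close>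

lemmas has_vector_derivative_matrix_mult = matrix_mult.has_vector_derivative
lemmas has_vector_derivative_transpose = bounded_linear.has_vector_derivative[OF bounded_linear_transpose]
lemmas continuous_on_matrix_mult [continuous_intros] = matrix_mult.continuous_on
lemmas continuous_on_transpose [continuous_intros] = bounded_linear.continuous_on[OF bounded_linear_transpose]

lemma transpose_matrix_inv:
  fixes X :: "real^'n^'n"
  assumes "det X \<noteq> 0"
  shows "transpose (matrix_inv X) = matrix_inv (transpose X)"
proof -
  have "transpose (matrix_inv X) ** (transpose X ** matrix_inv (transpose X)) = matrix_inv (transpose X)"
    by (simp only: matrix_mul_assoc matrix_transpose_mul[symmetric] matrix_inv_right[OF assms]) simp
  then show ?thesis
    using assms by (simp add: matrix_inv_right)
qed

text \<open>The skew part \<open>K\<close> changes \<open>L\<close> but drops out of the derivative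
  of \<open>L ** transpose L\<close>. Hence every skew \<open>K\<close> admits a factorization of
  the same path \<open>\<Lambda>\<close>.\<close>

lemma factor_path:
  fixes \<Lambda> S K :: "real \<Rightarrow> real^'n^'n"
  assumes d\<Lambda>: "\<And>t. t \<ge> t0 \<Longrightarrow> (\<Lambda> has_vector_derivative 2 *\<^sub>R S t) (at t within {t0..})"
    and cont: "continuous_on {t0..} S" "continuous_on {t0..} K"
    and S: "\<And>t. t \<ge> t0 \<Longrightarrow> transpose (S t) = S t"
    and K: "\<And>t. t \<ge> t0 \<Longrightarrow> transpose (K t) = - K t"
    and \<Lambda>: "\<And>t. t \<ge> t0 \<Longrightarrow> transpose (\<Lambda> t) = \<Lambda> t" "\<And>t. t \<ge> t0 \<Longrightarrow> det (\<Lambda> t) \<noteq> 0"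
    and L0: "L0 ** transpose L0 = \<Lambda> t0"
  obtains L where "L t0 = L0"
    "\<And>t. t \<ge> t0 \<Longrightarrow> (L has_vector_derivative (S t + K t) ** (matrix_inv (\<Lambda> t) ** L t)) (at t within {t0..})"
    "\<And>t. t \<ge> t0 \<Longrightarrow> L t ** transpose (L t) = \<Lambda> t"
proof -
  define G where "G t = (S t + K t) ** matrix_inv (\<Lambda> t)" for t
  have "continuous_on {t0..} \<Lambda>"
    using d\<Lambda> by (auto intro!: continuous_on_vector_derivative)
  then have contG: "continuous_on {t0..} G"
    unfolding G_def by (intro continuous_intros cont) (simp_all add: \<Lambda>)
  obtain L where L: "L t0 = L0"
    "\<And>t. t \<ge> t0 \<Longrightarrow> (L has_vector_derivative G t ** L t) (at t within {t0..})"
    using linear_ode_solution[OF bounded_bilinear_matrix_matrix_mult contG] by blast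
  \<comment> \<open>The defect of the factorization. It solves a homogeneous linear equation with
    initial value zero, so it vanishes.\<close>
  define D where "D t = L t ** transpose (L t) - \<Lambda> t" for t
  let ?D' = "\<lambda>t. G t ** D t + D t ** transpose (G t)"
  have dD: "(D has_vector_derivative ?D' t) (at t within {t0..})" if t: "t \<ge> t0" for t
  proof -
    have "(D has_vector_derivative (L t ** transpose (G t ** L t) + (G t ** L t) ** transpose (L t)) - 2 *\<^sub>R S t)
        (at t within {t0..})"
      unfolding D_def[abs_def]
      by (intro has_vector_derivative_diff has_vector_derivative_matrix_mult has_vector_derivative_transpose
          L(2) d\<Lambda> t)
    \<comment> \<open>The two summands are \<open>S t + K t\<close> and its transpose
      \<open>S t - K t\<close>.\<close>
    moreover have "G t ** \<Lambda> t + \<Lambda> t ** transpose (G t) = 2 *\<^sub>R S t"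
      using \<Lambda>[OF t]
      by (simp add: G_def matrix_expand transpose_matrix_inv matrix_inv_cancel matrix_inv_left S K t scaleR_2)
    then have "(L t ** transpose (G t ** L t) + (G t ** L t) ** transpose (L t)) - 2 *\<^sub>R S t = ?D' t"
      by (simp add: D_def matrix_expand algebra_simps)
    ultimately show ?thesis by simp
  qed
  obtain C where C: "\<And>(X::real^'n^'n) (Y::real^'n^'n). norm (X ** Y) \<le> norm X * norm Y * C"
    using matrix_mult.pos_bounded by blast
  have "D t = 0" if "t \<ge> t0" for t
  proof (rule gronwall_zero[OF dD])
    show "continuous_on {t0..} (\<lambda>t. (norm (G t) + norm (transpose (G t))) * C)"
      by (intro continuous_intros contG)
    show "norm (?D' t) \<le> (norm (G t) + norm (transpose (G t))) * C * norm (D t)" for t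
      using norm_triangle_le[OF add_mono[OF C[of "G t" "D t"] C[of "D t" "transpose (G t)"]]]
      by (simp add: algebra_simps)
    show "D t0 = 0"
      by (simp add: D_def L L0)
  qed (use that in auto)
  then have "L t ** transpose (L t) = \<Lambda> t" if "t \<ge> t0" for t
    using that by (simp add: D_def)
  with L show ?thesis
    using that[of L] by (simp add: G_def matrix_mul_assoc[symmetric])
qed

text \<open>The factor is obtained by transporting the identity along the path \<open>(1 - s)\<^sup>2 I + s X\<close>
  of positive definite matrices, which reaches \<open>X\<close> at \<open>s = 1\<close>.\<close>

lemma pos_definite_mat_factor:
  fixes X :: "real^'n^'n"
  assumes "pos_definite_mat X" and X: "transpose X = X"
  obtains L :: "real^'n^'n" where "L ** transpose L = X"
proof -
  \<comment> \<open>The square keeps the coefficient of the identity nonnegative beyond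
    \<open>s = 1\<close>, since \<open>factor_path\<close> asks for invertibility on the whole
    half-line. \<open>?S\<close> is half the derivative, and the skew part is taken to be
    zero.\<close>
  let ?\<Lambda> = "\<lambda>s::real. (1 - s)\<^sup>2 *\<^sub>R mat 1 + s *\<^sub>R X"
  let ?S = "\<lambda>s::real. (s - 1) *\<^sub>R mat 1 + (1/2) *\<^sub>R X"
  have "pos_definite_mat (?\<Lambda> s)" if "s \<ge> 0" for s
  proof -
    have "0 < (1 - s)\<^sup>2 * (v \<bullet> v) + s * (v \<bullet> (X *v v))" if "v \<noteq> 0" for v
    proof (cases "s = 0")
      case True
      then show ?thesis using that by simp
    next
      case False
      then show ?thesis
        using assms(1) that \<open>s \<ge> 0\<close> unfolding pos_definite_mat_def
        by (intro add_nonneg_pos mult_nonneg_nonneg mult_pos_pos) auto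
    qed
    then show ?thesis
      by (simp add: pos_definite_mat_def matrix_vector_mult_add_rdistrib inner_add_right
          flip: scaleR_matrix_vector_assoc)
  qed
  then have det: "det (?\<Lambda> s) \<noteq> 0" if "s \<ge> 0" for s
    using pos_definite_mat_imp_det_nonzero that by blast
  have "(?\<Lambda> has_vector_derivative 2 *\<^sub>R ?S s) (at s within {0..})" for s
  proof -
    have "((\<lambda>s::real. (1 - s)\<^sup>2) has_vector_derivative 2 * (s - 1)) (at s within {0..})"
      unfolding has_real_derivative_iff_has_vector_derivative[symmetric]
      by (rule derivative_eq_intros refl | simp)+
    then have "(?\<Lambda> has_vector_derivative (2 * (s - 1)) *\<^sub>R mat 1 + 1 *\<^sub>R X) (at s within {0..})"
      by (intro has_vector_derivative_add has_vector_derivative_id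
          bounded_linear.has_vector_derivative[OF bounded_linear_scaleR_left])
    then show ?thesis by (simp add: scaleR_add_right)
  qed
  then have "\<exists>L :: real \<Rightarrow> real^'n^'n. \<forall>s\<ge>0. L s ** transpose (L s) = ?\<Lambda> s"
  proof (rule factor_path[of 0 ?\<Lambda> ?S "\<lambda>_. 0" "mat 1"])
    show "continuous_on {0..} ?S"
      by (intro continuous_intros)
    show "continuous_on {0..} (\<lambda>_. 0 :: real^'n^'n)"
      by (intro continuous_intros)
    fix L :: "real \<Rightarrow> real^'n^'n" assume "\<And>s. s \<ge> 0 \<Longrightarrow> L s ** transpose (L s) = ?\<Lambda> s"
    then show "\<exists>L :: real \<Rightarrow> real^'n^'n. \<forall>s\<ge>0. L s ** transpose (L s) = ?\<Lambda> s"
      by blast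
  next
    show "det (?\<Lambda> s) \<noteq> 0" if "s \<ge> 0" for s
      using that by (rule det)
    show "transpose (0 :: real^'n^'n) = - 0"
      by (simp add: linear_0[OF bounded_linear.linear[OF bounded_linear_transpose]])
  qed (simp_all add: X transpose_add transpose_scalar)
  then obtain L :: "real \<Rightarrow> real^'n^'n" where "\<forall>s\<ge>0. L s ** transpose (L s) = ?\<Lambda> s" ..
  from this[rule_format, of 1] show ?thesis
    by (intro that) simp
qed

subsection \<open>Symmetry of the transformed coefficients\<close>

text \<open>With \<open>Y = matrix_inv L ** X\<close>, the matrix \<open>X ** transpose L\<close> is
  the congruence \<open>L ** Y ** transpose L\<close>, which preserves and reflects symmetry for
  invertible \<open>L\<close>. This clears the inverse from the formulas for \<open>V\<close> and
  \<open>W\<close>.\<close>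

lemma symmetric_conjugate_iff:
  fixes L X :: "real^'n^'n"
  assumes "det L \<noteq> 0"
  shows "symmetric_mat (matrix_inv L ** X) \<longleftrightarrow> symmetric_mat (X ** transpose L)"
proof -
  define Y where "Y = matrix_inv L ** X"
  have X: "X = L ** Y"
    by (simp add: Y_def matrix_inv_cancel assms)
  have "Y = transpose Y" if "L ** (Y ** transpose L) = L ** (transpose Y ** transpose L)"
  proof -
    from that have "matrix_inv L ** (L ** (Y ** transpose L)) = matrix_inv L ** (L ** (transpose Y ** transpose L))"
      by simp
    then have "Y ** transpose L = transpose Y ** transpose L"
      by (simp add: matrix_inv_cancel assms)
    then have "transpose (L ** transpose Y) = transpose (L ** Y)"
      by (simp add: matrix_transpose_mul)
    then have "matrix_inv L ** (L ** transpose Y) = matrix_inv L ** (L ** Y)"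
      by simp
    then show ?thesis by (simp add: matrix_inv_cancel assms)
  qed
  then have "symmetric_mat Y \<longleftrightarrow> symmetric_mat ((L ** Y) ** transpose L)"
    unfolding symmetric_mat_def by (auto simp: matrix_transpose_mul matrix_mul_assoc[symmetric])
  then show ?thesis
    by (simp only: Y_def[symmetric] X[symmetric])
qed

text \<open>Subtract the transpose. For \<open>\<Lambda> = L ** transpose L\<close> the right-hand
  side is \<open>4 K\<close>, so symmetry of \<open>V\<close> prescribes the skew part of
  \<open>L' ** transpose L\<close>.\<close>

lemma symmetric_first_coefficient_iff:
  fixes L L1 A :: "real^'n^'n"
  shows "symmetric_mat ((2 *\<^sub>R L1 + A ** L) ** transpose L) \<longleftrightarrow>
    2 *\<^sub>R (L1 ** transpose L - L ** transpose L1)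
      = (L ** transpose L) ** transpose A - A ** (L ** transpose L)"
  unfolding symmetric_mat_def
  by (simp add: matrix_expand) (auto simp: algebra_simps)

text \<open>With \<open>P = (2 L' + A L) L\<^sup>T\<close> symmetric, twice the second matrix below differs from
  \<open>- 2 M L L\<^sup>T\<close> only by the symmetric matrix \<open>P' - 2 L' L'\<^sup>T + A L L\<^sup>T A\<^sup>T / 2\<close>.\<close>

lemma symmetric_second_coefficient_iff:
  fixes L L1 L2 A A1 B :: "real^'n^'n"
  defines "M \<equiv> (1/2) *\<^sub>R A1 + (1/4) *\<^sub>R (A ** A) - B"
  assumes P: "symmetric_mat ((2 *\<^sub>R L1 + A ** L) ** transpose L)"
    and P1: "symmetric_mat ((2 *\<^sub>R L1 + A ** L) ** transpose L1
               + (2 *\<^sub>R L2 + (A ** L1 + A1 ** L)) ** transpose L)" (is "symmetric_mat ?P1")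
  shows "symmetric_mat ((L2 + A ** L1 + B ** L) ** transpose L) \<longleftrightarrow>
    (L ** transpose L) ** transpose M = M ** (L ** transpose L)"
proof -
  let ?Q = "(L2 + A ** L1 + B ** L) ** transpose L"
  let ?N = "M ** (L ** transpose L)"
  let ?R = "?P1 - 2 *\<^sub>R (L1 ** transpose L1) + (1/2) *\<^sub>R (A ** (L ** (transpose L ** transpose A)))"
  \<comment> \<open>The symmetry of \<open>V\<close>, multiplied by \<open>A\<close> from the left,
    is exactly what cancels the mixed terms in the next identity.\<close>
  have "A ** (2 *\<^sub>R (L1 ** transpose L - L ** transpose L1))
      = A ** ((L ** transpose L) ** transpose A - A ** (L ** transpose L))"
    using P unfolding symmetric_first_coefficient_iff by simp
  then have "2 *\<^sub>R ?Q + 2 *\<^sub>R (M ** (L ** transpose L)) = ?R"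
    by (simp add: M_def matrix_expand vec_eq_iff) (simp add: field_simps)
  moreover have "transpose ?R = ?R"
    using P1 by (simp add: symmetric_mat_def transpose_add transpose_diff transpose_scalar)
      (simp add: matrix_expand)
  ultimately have "transpose (2 *\<^sub>R ?Q + 2 *\<^sub>R (M ** (L ** transpose L)))
      = 2 *\<^sub>R ?Q + 2 *\<^sub>R (M ** (L ** transpose L))"
    by simp
  then have "2 *\<^sub>R (transpose ?Q + transpose ?N) = 2 *\<^sub>R (?Q + ?N)"
    by (simp only: transpose_add transpose_scalar scaleR_add_right)
  then have "transpose ?Q + transpose ?N = ?Q + ?N"
    by (simp only: scaleR_cancel_left) simp
  then have "transpose ?Q - ?Q = ?N - transpose ?N"
    by (simp add: algebra_simps)
  then show ?thesis
    unfolding symmetric_mat_def by (auto simp: matrix_transpose_mul matrix_mul_assoc[symmetric])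
qed

text \<open>Both \<open>F'\<close> and its transpose are derivatives of \<open>F\<close> at
  \<open>t\<close>, and one-sided derivatives are unique.\<close>

lemma has_vector_derivative_symmetric:
  assumes "\<And>t. t \<ge> t0 \<Longrightarrow> symmetric_mat (F t)"
    and F: "(F has_vector_derivative F') (at t within {t0..})" and t: "t \<ge> t0"
  shows "symmetric_mat F'"
proof -
  have "((\<lambda>s. transpose (F s)) has_vector_derivative transpose F') (at t within {t0..})"
    by (intro has_vector_derivative_transpose F)
  then have "(F has_vector_derivative transpose F') (at t within {t0..})"
    using assms(1) t by (intro has_vector_derivative_transform[where g = F]) (auto simp: symmetric_mat_def)
  from nderiv_1_eqI[OF F t] nderiv_1_eqI[OF this t] show ?thesis
    by (simp add: symmetric_mat_def)
qed

text \<open>The pointwise criterion needs the derivative of \<open>(2 L' + A L) L\<^sup>T\<close> to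
  be symmetric; this follows by differentiating the symmetry of \<open>V\<close> in time.\<close>

lemma symmetric_system_iff:
  fixes L L' L'' A A' B :: "real \<Rightarrow> real^'n^'n"
  assumes dL: "\<And>t. t \<ge> t0 \<Longrightarrow> (L has_vector_derivative L' t) (at t within {t0..})"
    and dL': "\<And>t. t \<ge> t0 \<Longrightarrow> (L' has_vector_derivative L'' t) (at t within {t0..})"
    and dA: "\<And>t. t \<ge> t0 \<Longrightarrow> (A has_vector_derivative A' t) (at t within {t0..})"
    and V: "\<And>t. t \<ge> t0 \<Longrightarrow> symmetric_mat ((2 *\<^sub>R L' t + A t ** L t) ** transpose (L t))"
    and t: "t \<ge> t0"
  shows "symmetric_mat ((L'' t + A t ** L' t + B t ** L t) ** transpose (L t)) \<longleftrightarrow>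
    (L t ** transpose (L t)) ** transpose ((1/2) *\<^sub>R A' t + (1/4) *\<^sub>R (A t ** A t) - B t)
      = ((1/2) *\<^sub>R A' t + (1/4) *\<^sub>R (A t ** A t) - B t) ** (L t ** transpose (L t))"
proof (rule symmetric_second_coefficient_iff[OF V[OF t]])
  have "((\<lambda>t. (2 *\<^sub>R L' t + A t ** L t) ** transpose (L t)) has_vector_derivative
      (2 *\<^sub>R L' t + A t ** L t) ** transpose (L' t)
        + (2 *\<^sub>R L'' t + (A t ** L' t + A' t ** L t)) ** transpose (L t)) (at t within {t0..})"
    by (intro has_vector_derivative_add has_vector_derivative_matrix_mult has_vector_derivative_transpose
        bounded_linear.has_vector_derivative[OF bounded_linear_scaleR_right] dL dL' dA t)
  from has_vector_derivative_symmetric[OF V this t]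
  show "symmetric_mat ((2 *\<^sub>R L' t + A t ** L t) ** transpose (L' t)
        + (2 *\<^sub>R L'' t + (A t ** L' t + A' t ** L t)) ** transpose (L t))" .
qed

text \<open>The trace is a bounded linear map and so commutes with the integral: the first condition
  bounds the trace of \<open>\<Lambda>\<close>.\<close>

lemma trace_integral:
  fixes S :: "real \<Rightarrow> real^'n^'n"
  assumes "continuous_on {t0..} S"
  shows "2 * integral {t0..t} (\<lambda>\<nu>. trace (S \<nu>)) + trace S0 = trace (2 *\<^sub>R integral {t0..t} S + S0)"
proof -
  have "S integrable_on {t0..t}"
    using assms by (intro integrable_continuous_real) (auto elim: continuous_on_subset)
  from integral_linear[OF this bounded_linear_trace]
  show ?thesis
    by (simp add: o_def linear_add linear_scale bounded_linear.linear[OF bounded_linear_trace])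
qed

lemma has_vector_derivative_integral_atLeast:
  fixes S :: "real \<Rightarrow> 'a::banach"
  assumes S: "continuous_on {t0..} S" and t: "t \<ge> t0"
  shows "((\<lambda>t. integral {t0..t} S) has_vector_derivative S t) (at t within {t0..})"
proof -
  have "at t within {t0..} = at t within {t0..t + 1}"
    by (rule at_within_nhd[of _ "{t - 1<..<t + 1}"]) auto
  moreover have "continuous_on {t0..t + 1} S"
    using S by (rule continuous_on_subset) auto
  ultimately show ?thesis
    using integral_has_vector_derivative[of t0 "t + 1" S t] t by simp
qed

text \<open>In \<open>ereal\<close> a sum is \<open>\<infinity>\<close> as soon as one summand is,
  even if the other is \<open>-\<infinity>\<close>.\<close>

lemma sup_nderiv_add_less_infinity_iff:
  "sup_nderiv N t0 i F + sup_nderiv N t0 i G < \<infinity> \<longleftrightarrow>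
    sup_nderiv N t0 i F < \<infinity> \<and> sup_nderiv N t0 i G < \<infinity>"
  by (cases "sup_nderiv N t0 i F"; cases "sup_nderiv N t0 i G") auto

subsection \<open>Symmetrizability and the conditions on S\<close>

text \<open>\<open>S\<close> and \<open>K\<close> are built from \<open>L\<close> and
  \<open>L'\<close>, so their derivatives of order \<open>i\<close> involve \<open>L\<close> up to
  order \<open>i + 1\<close>; this explains the range \<open>i < k\<close>.\<close>

lemma symmetrizable_imp_conditions:
  fixes A B :: "real \<Rightarrow> real^'m^'m"
  assumes N: "is_matrix_norm N" and A: "C_class 1 t0 A" and L: "L_matrix N k t0 L"
    and "k \<le> 2"
    and V: "\<And>t. t \<ge> t0 \<Longrightarrow> symmetric_mat (matrix_inv (L t) ** (2 *\<^sub>R nderiv t0 1 L t + A t ** L t))"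
    and W: "\<And>t. t \<ge> t0 \<Longrightarrow> symmetric_mat
      (matrix_inv (L t) ** (nderiv t0 2 L t + A t ** nderiv t0 1 L t + B t ** L t))"
  defines "\<Lambda> \<equiv> (\<lambda>S S0 t. 2 *\<^sub>R integral {t0..t} S + S0)"
  defines "K \<equiv> (\<lambda>S S0 t. (1/4) *\<^sub>R (\<Lambda> S S0 t ** transpose (A t) - A t ** \<Lambda> S S0 t))"
    and "M \<equiv> (\<lambda>t. (1/2) *\<^sub>R nderiv t0 1 A t + (1/4) *\<^sub>R (A t ** A t) - B t)"
  obtains S S0 \<mu> \<eta> where
    "C_class 1 t0 S" "\<And>t. t \<ge> t0 \<Longrightarrow> symmetric_mat (S t)"
    "symmetric_mat S0" "pos_definite_mat S0" "\<mu> > 0" "\<eta> > 0"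
    "\<And>t. t \<ge> t0 \<Longrightarrow> \<bar>trace (\<Lambda> S S0 t)\<bar> \<le> \<mu>\<^sup>2" "\<And>t. t \<ge> t0 \<Longrightarrow> \<eta>\<^sup>2 \<le> det (\<Lambda> S S0 t)"
    "\<And>i. i < k \<Longrightarrow> sup_nderiv N t0 i (K S S0) < \<infinity> \<and> sup_nderiv N t0 i S < \<infinity>"
    "\<And>t. t \<ge> t0 \<Longrightarrow> \<Lambda> S S0 t ** transpose (M t) = M t ** \<Lambda> S S0 t"
proof -
  from L obtain \<eta> where C2: "C_class 2 t0 L" and \<eta>: "\<eta> > 0" "\<And>t. t \<ge> t0 \<Longrightarrow> \<eta> < \<bar>det (L t)\<bar>"
    and bd: "\<And>i. i \<le> k \<Longrightarrow> bounded (nderiv t0 i L ` {t0..})"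
    unfolding L_matrix_def sup_nderiv_less_infinity_iff[OF N] by blast
  have det: "det (L t) \<noteq> 0" if "t \<ge> t0" for t
    using \<eta>(1) \<eta>(2)[OF that] by auto
  from C2 obtain L' L'' where contL'': "continuous_on {t0..} L''"
    and dL: "\<And>t. t \<ge> t0 \<Longrightarrow> (L has_vector_derivative L' t) (at t within {t0..})"
    and dL': "\<And>t. t \<ge> t0 \<Longrightarrow> (L' has_vector_derivative L'' t) (at t within {t0..})"
    unfolding C_class_2_iff by blast
  from A obtain A' where dA: "\<And>t. t \<ge> t0 \<Longrightarrow> (A has_vector_derivative A' t) (at t within {t0..})"
    unfolding C_class_1_iff by blast
  have L'_eq: "nderiv t0 1 L t = L' t" and L''_eq: "nderiv t0 2 L t = L'' t" and A'_eq: "nderiv t0 1 A t = A' t"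
    if "t \<ge> t0" for t
    using that nderiv_1_eqI[OF dL] nderiv_2_eqI[OF dL _ dL'] nderiv_1_eqI[OF dA] by auto
  have cont: "continuous_on {t0..} L" "continuous_on {t0..} L'"
    using dL dL' by (auto intro!: continuous_on_vector_derivative)
  \<comment> \<open>\<open>S\<close> and \<open>K1\<close> are the symmetric and skew parts of
    \<open>L' ** transpose L\<close>; \<open>S\<close> is half the derivative of
    \<open>L ** transpose L\<close>.\<close>
  define S where "S t = (1/2) *\<^sub>R (L' t ** transpose (L t) + L t ** transpose (L' t))" for t
  define S0 where "S0 = L t0 ** transpose (L t0)"
  define K1 where "K1 t = (1/2) *\<^sub>R (L' t ** transpose (L t) - L t ** transpose (L' t))" for t
  define S' where "S' t = (1/2) *\<^sub>R (L' t ** transpose (L' t) + L'' t ** transpose (L t)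
    + (L t ** transpose (L'' t) + L' t ** transpose (L' t)))" for t
  define K1' where "K1' t = (1/2) *\<^sub>R (L' t ** transpose (L' t) + L'' t ** transpose (L t)
    - (L t ** transpose (L'' t) + L' t ** transpose (L' t)))" for t
  have dS: "(S has_vector_derivative S' t) (at t within {t0..})"
    and dK1: "(K1 has_vector_derivative K1' t) (at t within {t0..})"
    and dLL: "((\<lambda>t. L t ** transpose (L t)) has_vector_derivative 2 *\<^sub>R S t) (at t within {t0..})" if "t \<ge> t0" for t
  proof -
    show "(S has_vector_derivative S' t) (at t within {t0..})"
      unfolding S_def[abs_def] S'_def
      by (intro has_vector_derivative_add has_vector_derivative_matrix_mult has_vector_derivative_transpose
        bounded_linear.has_vector_derivative[OF bounded_linear_scaleR_right] dL dL' that)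
    show "(K1 has_vector_derivative K1' t) (at t within {t0..})"
      unfolding K1_def[abs_def] K1'_def
      by (intro has_vector_derivative_diff has_vector_derivative_matrix_mult has_vector_derivative_transpose
        bounded_linear.has_vector_derivative[OF bounded_linear_scaleR_right] dL dL' that)
    have "((\<lambda>t. L t ** transpose (L t)) has_vector_derivative L t ** transpose (L' t) + L' t ** transpose (L t))
        (at t within {t0..})"
      by (intro has_vector_derivative_matrix_mult has_vector_derivative_transpose dL that)
    then show "((\<lambda>t. L t ** transpose (L t)) has_vector_derivative 2 *\<^sub>R S t) (at t within {t0..})"
      by (simp add: S_def add.commute)
  qed
  have \<Lambda>_eq: "\<Lambda> S S0 t = L t ** transpose (L t)" if t: "t \<ge> t0" for t
  proof -
    have "((\<lambda>s. 2 *\<^sub>R S s) has_integral L t ** transpose (L t) - S0) {t0..t}"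
      unfolding S0_def
      by (rule fundamental_theorem_of_calculus[OF t]) (auto intro: has_vector_derivative_within_subset[OF dLL])
    then show ?thesis
      by (simp add: \<Lambda>_def integral_unique flip: integral_cmul)
  qed
  have P: "symmetric_mat ((2 *\<^sub>R L' t + A t ** L t) ** transpose (L t))" if t: "t \<ge> t0" for t
    using V[OF t] by (simp add: symmetric_conjugate_iff[OF det[OF t]] L'_eq[OF t, unfolded One_nat_def])
  \<comment> \<open>Symmetry of \<open>V\<close> identifies \<open>K\<close>, defined through
    \<open>A\<close>, with \<open>K1\<close>, which involves only \<open>L\<close>. Bounds on
    \<open>K\<close> and its derivative thus require no bound on \<open>A\<close>.\<close>
  have K_eq: "K S S0 t = K1 t" if t: "t \<ge> t0" for t
    using P[OF t, unfolded symmetric_first_coefficient_iff, symmetric]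
    by (simp add: K_def K1_def \<Lambda>_eq t)
  have dK: "(K S S0 has_vector_derivative K1' t) (at t within {t0..})" if "t \<ge> t0" for t
    by (rule has_vector_derivative_transform[OF _ _ dK1]) (use K_eq that in auto)
  have bL: "bounded (L ` {t0..})"
    using bd[of 0] by simp
  then obtain r where r: "r > 0" "\<And>t. t \<ge> t0 \<Longrightarrow> norm (L t) \<le> r"
    by (auto simp: bounded_pos)
  have bL': "bounded (L' ` {t0..})" if "k \<ge> 1"
    using bd[OF that] L'_eq by (metis (no_types, lifting) atLeast_iff image_cong)
  have bL'': "bounded (L'' ` {t0..})" if "k \<ge> 2"
    using bd[OF that] L''_eq by (metis (no_types, lifting) atLeast_iff image_cong)
  show ?thesis
  \<comment> \<open>The Frobenius bound \<open>r\<close> on \<open>L\<close> serves as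
    \<open>\<mu>\<close>, because the trace of \<open>\<Lambda>\<close> is the squared norm of
    \<open>L\<close>; the lower bound on the determinant of \<open>L\<close> serves as
    \<open>\<eta>\<close>, because \<open>det \<Lambda>\<close> is its square.\<close>
  proof (rule that[of S S0 r \<eta>])
    have "continuous_on {t0..} S'"
      unfolding S'_def by (intro continuous_intros cont contL'')
    then show "C_class 1 t0 S"
      unfolding C_class_1_iff using dS by blast
    show "symmetric_mat (S t)" for t
      by (simp add: symmetric_mat_def S_def matrix_expand add.commute)
    show "symmetric_mat S0"
      by (simp add: symmetric_mat_def S0_def matrix_transpose_mul)
    show "pos_definite_mat S0"
      unfolding pos_definite_mat_def
    proof (intro allI impI)
      fix v :: "real^'m" assume "v \<noteq> 0"
      \<comment> \<open>\<open>transpose (L t0)\<close> is injective, and the quadratic form of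
        \<open>S0\<close> at \<open>v\<close> is the squared length of
        \<open>transpose (L t0) *v v\<close>.\<close>
      have "transpose (matrix_inv (L t0)) ** transpose (L t0) = mat 1"
        by (simp add: matrix_inv_right det flip: matrix_transpose_mul)
      then have "v = transpose (matrix_inv (L t0)) *v (transpose (L t0) *v v)"
        by (simp add: matrix_vector_mul_assoc del: transpose_matrix_vector)
      with \<open>v \<noteq> 0\<close> have "transpose (L t0) *v v \<noteq> 0"
        by (auto simp del: transpose_matrix_vector)
      moreover have "v \<bullet> (S0 *v v) = (transpose (L t0) *v v) \<bullet> (transpose (L t0) *v v)"
        by (simp add: S0_def matrix_vector_mul_assoc[symmetric] dot_lmul_matrix)
      ultimately show "0 < v \<bullet> (S0 *v v)"
        by simp
    qed
    show "\<bar>trace (\<Lambda> S S0 t)\<bar> \<le> r\<^sup>2" if "t \<ge> t0" for t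
      using r(2)[OF that] by (simp add: \<Lambda>_eq that trace_mult_transpose power_mono)
    show "\<eta>\<^sup>2 \<le> det (\<Lambda> S S0 t)" if "t \<ge> t0" for t
      using \<eta>(1) \<eta>(2)[OF that] power_mono[of \<eta> "\<bar>det (L t)\<bar>" 2]
      by (simp add: \<Lambda>_eq that det_mul power2_eq_square)
    show "\<Lambda> S S0 t ** transpose (M t) = M t ** \<Lambda> S S0 t" if t: "t \<ge> t0" for t
    proof -
      have "symmetric_mat ((L'' t + A t ** L' t + B t ** L t) ** transpose (L t))"
        using W[OF t] unfolding symmetric_conjugate_iff[OF det[OF t]] L'_eq[OF t] L''_eq[OF t] .
      then show ?thesis
        unfolding M_def \<Lambda>_eq[OF t] A'_eq[OF t]
        using symmetric_system_iff[OF dL dL' dA P t, of B] by simp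
    qed
    show "sup_nderiv N t0 i (K S S0) < \<infinity> \<and> sup_nderiv N t0 i S < \<infinity>" if "i < k" for i
    proof -
      have "bounded (nderiv t0 i (K S S0) ` {t0..}) \<and> bounded (nderiv t0 i S ` {t0..})"
      proof (cases "i = 0")
        case True
        have "bounded (K1 ` {t0..})" "bounded (S ` {t0..})"
          unfolding K1_def S_def using that
          by (intro bounded_scaleR_comp bounded_plus_comp bounded_minus_comp bounded_matrix_mult
              bounded_transpose bL bL'; simp)+
        moreover have "K S S0 ` {t0..} = K1 ` {t0..}"
          using K_eq by auto
        ultimately show ?thesis using True by simp
      next
        case False
        with that \<open>k \<le> 2\<close> have "i = 1" "k = 2" by auto
        have "bounded (K1' ` {t0..})" "bounded (S' ` {t0..})"
          unfolding K1'_def S'_def using \<open>k = 2\<close>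
          by (intro bounded_scaleR_comp bounded_plus_comp bounded_minus_comp bounded_matrix_mult
              bounded_transpose bL bL' bL''; simp)+
        moreover have "nderiv t0 i (K S S0) ` {t0..} = K1' ` {t0..}" "nderiv t0 i S ` {t0..} = S' ` {t0..}"
          unfolding \<open>i = 1\<close> using nderiv_1_eqI[OF dK] nderiv_1_eqI[OF dS] by auto
        ultimately show ?thesis by simp
      qed
      then show ?thesis unfolding sup_nderiv_less_infinity_iff[OF N] .
    qed
  qed (use r \<eta> in auto)
qed

text \<open>The equation \<open>L' = (S + K) \<Lambda>\<^sup>-\<^sup>1 L\<close> expresses the
  derivatives of \<open>L\<close> through those of \<open>S\<close> and \<open>K\<close> of one
  order less. Together with bounds on \<open>L\<close> and \<open>\<Lambda>\<^sup>-\<^sup>1\<close>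
  this yields the \<open>L_matrix\<close> estimates.\<close>

lemma conditions_imp_symmetrizable:
  fixes A B :: "real \<Rightarrow> real^'m^'m"
  assumes N: "is_matrix_norm N" and A: "C_class 1 t0 A" and B: "C_class 0 t0 B"
    and "k \<le> 2"
    and S: "C_class 1 t0 S" "\<And>t. t \<ge> t0 \<Longrightarrow> symmetric_mat (S t)"
    and S0: "symmetric_mat S0" "pos_definite_mat S0"
    and "\<eta> > 0"
  defines "\<Lambda> \<equiv> (\<lambda>t. 2 *\<^sub>R integral {t0..t} S + S0)"
  defines "K \<equiv> (\<lambda>t. (1/4) *\<^sub>R (\<Lambda> t ** transpose (A t) - A t ** \<Lambda> t))"
    and "M \<equiv> (\<lambda>t. (1/2) *\<^sub>R nderiv t0 1 A t + (1/4) *\<^sub>R (A t ** A t) - B t)"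
  assumes tr: "\<And>t. t \<ge> t0 \<Longrightarrow> \<bar>trace (\<Lambda> t)\<bar> \<le> \<mu>\<^sup>2"
    and det: "\<And>t. t \<ge> t0 \<Longrightarrow> \<eta>\<^sup>2 \<le> det (\<Lambda> t)"
    and fin: "\<And>i. i < k \<Longrightarrow> sup_nderiv N t0 i K < \<infinity> \<and> sup_nderiv N t0 i S < \<infinity>"
    and M: "\<And>t. t \<ge> t0 \<Longrightarrow> \<Lambda> t ** transpose (M t) = M t ** \<Lambda> t"
  obtains V W where "C_class 0 t0 V" "C_class 0 t0 W" "L_equivalent N k t0 (A, B) (V, W)"
    "\<And>t. t \<ge> t0 \<Longrightarrow> symmetric_mat (V t) \<and> symmetric_mat (W t)"
proof -
  from A obtain A' where contA': "continuous_on {t0..} A'"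
    and dA: "\<And>t. t \<ge> t0 \<Longrightarrow> (A has_vector_derivative A' t) (at t within {t0..})"
    unfolding C_class_1_iff by blast
  from S(1) obtain S' where contS': "continuous_on {t0..} S'"
    and dS: "\<And>t. t \<ge> t0 \<Longrightarrow> (S has_vector_derivative S' t) (at t within {t0..})"
    unfolding C_class_1_iff by blast
  have contB: "continuous_on {t0..} B"
    using B unfolding C_class_0_iff .
  have contA: "continuous_on {t0..} A" and contS: "continuous_on {t0..} S"
    using dA dS by (auto intro!: continuous_on_vector_derivative)
  have d\<Lambda>: "(\<Lambda> has_vector_derivative 2 *\<^sub>R S t) (at t within {t0..})" if "t \<ge> t0" for t
  proof -
    have "(\<Lambda> has_vector_derivative 2 *\<^sub>R S t + 0) (at t within {t0..})"
      unfolding \<Lambda>_def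
      by (intro has_vector_derivative_add bounded_linear.has_vector_derivative[OF bounded_linear_scaleR_right]
          has_vector_derivative_integral_atLeast contS that has_vector_derivative_const)
    then show ?thesis by simp
  qed
  have cont\<Lambda>: "continuous_on {t0..} \<Lambda>"
    using d\<Lambda> by (auto intro!: continuous_on_vector_derivative)
  have S_tr: "transpose (S t) = S t" if "t \<ge> t0" for t
    using S(2)[OF that] by (simp add: symmetric_mat_def)
  have \<Lambda>_tr: "transpose (\<Lambda> t) = \<Lambda> t" if "t \<ge> t0" for t
  proof -
    have "S integrable_on {t0..t}"
      using contS by (intro integrable_continuous_real) (auto elim: continuous_on_subset)
    from integral_linear[OF this bounded_linear_transpose]
    have "transpose (integral {t0..t} S) = integral {t0..t} (\<lambda>s. transpose (S s))"
      by (simp add: o_def)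
    also have "\<dots> = integral {t0..t} S"
      by (rule integral_cong) (simp add: S_tr)
    finally show ?thesis
      using S0(1) by (simp add: \<Lambda>_def transpose_add transpose_scalar symmetric_mat_def)
  qed
  have det0: "det (\<Lambda> t) \<noteq> 0" if "t \<ge> t0" for t
    using det[OF that] \<open>\<eta> > 0\<close> by (auto simp: not_le)
  \<comment> \<open>\<open>K\<close> inherits a continuous derivative from \<open>A\<close> and
    \<open>\<Lambda>\<close>; this is what makes \<open>L\<close> twice continuously
    differentiable.\<close>
  define K' where "K' t = (1/4) *\<^sub>R (\<Lambda> t ** transpose (A' t) + (2 *\<^sub>R S t) ** transpose (A t)
    - (A t ** (2 *\<^sub>R S t) + A' t ** \<Lambda> t))" for t
  have dK: "(K has_vector_derivative K' t) (at t within {t0..})" if "t \<ge> t0" for t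
    unfolding K_def K'_def
    by (intro has_vector_derivative_diff has_vector_derivative_matrix_mult has_vector_derivative_transpose
        bounded_linear.has_vector_derivative[OF bounded_linear_scaleR_right] d\<Lambda> dA that)
  have K_tr: "transpose (K t) = - K t" if "t \<ge> t0" for t
    using \<Lambda>_tr[OF that] by (simp add: K_def matrix_expand flip: scaleR_minus_right)
  have contK: "continuous_on {t0..} K"
    using dK by (auto intro!: continuous_on_vector_derivative)
  have contK': "continuous_on {t0..} K'"
    unfolding K'_def by (intro continuous_intros cont\<Lambda> contA contA' contS)
  have "transpose S0 = S0"
    using S0(1) by (simp add: symmetric_mat_def)
  with S0(2) obtain L0 :: "real^'m^'m" where "L0 ** transpose L0 = S0"
    by (rule pos_definite_mat_factor)
  then have L0: "L0 ** transpose L0 = \<Lambda> t0"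
    by (simp add: \<Lambda>_def)
  \<comment> \<open>Written as a function of \<open>L\<close>, so that the right-hand side of the
    equation has a name before the solution is obtained.\<close>
  define L' where "L' L t = (S t + K t) ** (matrix_inv (\<Lambda> t) ** L t)" for L :: "real \<Rightarrow> real^'m^'m" and t
  obtain L where dL: "\<And>t. t \<ge> t0 \<Longrightarrow> (L has_vector_derivative L' L t) (at t within {t0..})"
    and LL: "\<And>t. t \<ge> t0 \<Longrightarrow> L t ** transpose (L t) = \<Lambda> t"
    using factor_path[OF d\<Lambda> contS contK S_tr K_tr \<Lambda>_tr det0 L0] unfolding L'_def by blast
  let ?L' = "L' L"
  have contL: "continuous_on {t0..} L"
    using dL by (auto intro!: continuous_on_vector_derivative)
  have contL': "continuous_on {t0..} ?L'"
    unfolding L'_def by (intro continuous_intros contL contK contS cont\<Lambda>) (simp add: det0)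
  \<comment> \<open>\<open>R'\<close> is the derivative of \<open>R\<close>, by the product rule and
    the derivative of the inverse, so that \<open>L' = (S + K) R\<close> can be differentiated once
    more.\<close>
  define R where "R t = matrix_inv (\<Lambda> t) ** L t" for t
  define R' where "R' t = matrix_inv (\<Lambda> t) ** ?L' t
    + (- (matrix_inv (\<Lambda> t) ** ((2 *\<^sub>R S t) ** matrix_inv (\<Lambda> t)))) ** L t" for t
  define L'' where "L'' t = (S t + K t) ** R' t + (S' t + K' t) ** R t" for t
  have dL': "(?L' has_vector_derivative L'' t) (at t within {t0..})" if "t \<ge> t0" for t
    unfolding L'_def[abs_def] L''_def R_def R'_def using that
    by (intro has_vector_derivative_add has_vector_derivative_matrix_mult has_vector_derivative_matrix_inv
        dL[unfolded L'_def] d\<Lambda> dS dK cont\<Lambda>) (auto simp: det0)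
  have contL'': "continuous_on {t0..} L''"
    unfolding L''_def R_def R'_def
    by (intro continuous_intros contL contL' contK contS contK' contS' cont\<Lambda>) (simp_all add: det0)
  have L'_eq: "nderiv t0 1 L t = ?L' t" and L''_eq: "nderiv t0 2 L t = L'' t" and A'_eq: "nderiv t0 1 A t = A' t"
    and K'_eq: "nderiv t0 1 K t = K' t" and S'_eq: "nderiv t0 1 S t = S' t"
    if "t \<ge> t0" for t
    using that nderiv_1_eqI[OF dL] nderiv_2_eqI[OF dL _ dL'] nderiv_1_eqI[OF dA] nderiv_1_eqI[OF dK]
      nderiv_1_eqI[OF dS] by auto
  have det_sq: "(det (L t))\<^sup>2 = det (\<Lambda> t)" if "t \<ge> t0" for t
    by (simp add: det_mul power2_eq_square flip: LL[OF that])
  have detL: "\<eta> \<le> \<bar>det (L t)\<bar>" if "t \<ge> t0" for t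
    using det[OF that] \<open>\<eta> > 0\<close> abs_le_square_iff[of \<eta> "det (L t)"] by (simp add: det_sq that)
  have detL0: "det (L t) \<noteq> 0" if "t \<ge> t0" for t
    using detL[OF that] \<open>\<eta> > 0\<close> by auto
  have Lm: "L_matrix N k t0 L"
    unfolding L_matrix_def sup_nderiv_less_infinity_iff[OF N]
  proof (intro conjI allI impI)
    show "C_class 2 t0 L"
      unfolding C_class_2_iff using contL'' dL dL' by blast
    show "\<exists>\<eta>>0. \<forall>t\<ge>t0. \<eta> < \<bar>det (L t)\<bar>"
      \<comment> \<open>\<open>L_matrix\<close> asks for a strict inequality, hence the halved
        bound.\<close>
      using \<open>\<eta> > 0\<close> detL by (intro exI[of _ "\<eta> / 2"]) fastforce
    fix i assume "i \<le> k"
    \<comment> \<open>The squared norm of \<open>L t\<close> is the trace of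
      \<open>\<Lambda> t\<close>, at most \<open>\<mu>\<^sup>2\<close>.\<close>
    have "norm (L t) \<le> \<bar>\<mu>\<bar>" if "t \<ge> t0" for t
      using tr[OF that] abs_le_square_iff[of "norm (L t)" \<mu>]
      by (simp add: trace_mult_transpose flip: LL[OF that])
    then have bL: "bounded (L ` {t0..})"
      by (auto simp: bounded_iff)
    have "bounded ((\<lambda>t. L t ** transpose (L t)) ` {t0..})"
      by (intro bounded_matrix_mult bounded_transpose bL)
    then have "bounded (\<Lambda> ` {t0..})"
      using LL by (metis (no_types, lifting) atLeast_iff image_cong)
    \<comment> \<open>Boundedness of \<open>\<Lambda>\<close> alone is not enough; the lower bound
      \<open>\<eta>\<^sup>2\<close> on its determinant keeps the inverse bounded.\<close>
    then have b\<Lambda>: "bounded ((\<lambda>t. matrix_inv (\<Lambda> t)) ` {t0..})"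
      by (rule bounded_matrix_inv[of _ _ "\<eta>\<^sup>2"]) (use \<open>\<eta> > 0\<close> det in \<open>force+\<close>)
    have bR: "bounded (R ` {t0..})"
      unfolding R_def by (intro bounded_matrix_mult b\<Lambda> bL)
    have fin': "bounded (nderiv t0 j K ` {t0..}) \<and> bounded (nderiv t0 j S ` {t0..})" if "j < k" for j
      using fin[OF that] unfolding sup_nderiv_less_infinity_iff[OF N] .
    have bL': "bounded (?L' ` {t0..})" if "k \<ge> 1"
      unfolding L'_def using fin'[of 0] that
      by (intro bounded_matrix_mult bounded_plus_comp bR[unfolded R_def]) auto
    have bL'': "bounded (L'' ` {t0..})" if "k \<ge> 2"
    proof -
      have "bounded (K ` {t0..})" "bounded (S ` {t0..})"
        using fin'[of 0] that by auto
      moreover have "nderiv t0 1 K ` {t0..} = K' ` {t0..}" "nderiv t0 1 S ` {t0..} = S' ` {t0..}"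
        using K'_eq S'_eq by auto
      then have "bounded (K' ` {t0..})" "bounded (S' ` {t0..})"
        using fin'[of 1] that by auto
      moreover have "bounded (?L' ` {t0..})"
        using bL' that by simp
      moreover have neg: "bounded ((\<lambda>t. - F t) ` {t0..})" if "bounded (F ` {t0..})" for F :: "real \<Rightarrow> real^'m^'m"
        using that bounded_uminus[of "F ` {t0..}"] by (simp add: image_image)
      ultimately show ?thesis
        unfolding L''_def R'_def
        by (intro bounded_matrix_mult neg bounded_plus_comp bounded_scaleR_comp bR bL b\<Lambda>)
    qed
    consider "i = 0" | "i = 1" | "i = 2" using \<open>i \<le> k\<close> \<open>k \<le> 2\<close> by linarith
    then show "bounded (nderiv t0 i L ` {t0..})"
    proof cases
      case 1
      then show ?thesis using bL by simp
    next
      case 2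
      moreover have "nderiv t0 1 L ` {t0..} = ?L' ` {t0..}" using L'_eq by auto
      ultimately show ?thesis using bL' \<open>i \<le> k\<close> by simp
    next
      case 3
      moreover have "nderiv t0 2 L ` {t0..} = L'' ` {t0..}" using L''_eq by auto
      ultimately show ?thesis using bL'' \<open>i \<le> k\<close> by simp
    qed
  qed
  have P: "symmetric_mat ((2 *\<^sub>R ?L' t + A t ** L t) ** transpose (L t))" if t: "t \<ge> t0" for t
  proof -
    \<comment> \<open>\<open>L ** transpose L = \<Lambda>\<close> cancels the inverse, so
      \<open>S\<close> and \<open>K\<close> are the symmetric and skew parts of
      \<open>L' ** transpose L\<close>. By the definition of \<open>K\<close>, the skew part is the
      one that symmetry of \<open>V\<close> demands.\<close>
    have U: "?L' t ** transpose (L t) = S t + K t"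
      by (simp add: L'_def matrix_mul_assoc[symmetric] LL matrix_inv_left det0 t)
    have "L t ** transpose (?L' t) = transpose (?L' t ** transpose (L t))"
      by (simp add: matrix_transpose_mul)
    then have "L t ** transpose (?L' t) = S t - K t"
      by (simp add: U transpose_add S_tr K_tr t)
    then have "2 *\<^sub>R (?L' t ** transpose (L t) - L t ** transpose (?L' t)) = 4 *\<^sub>R K t"
      by (simp add: U scaleR_2[symmetric])
    then show ?thesis
      unfolding symmetric_first_coefficient_iff LL[OF t] by (simp add: K_def)
  qed
  have Q: "symmetric_mat ((L'' t + A t ** ?L' t + B t ** L t) ** transpose (L t))" if t: "t \<ge> t0" for t
    using symmetric_system_iff[OF dL dL' dA P t, of B] M[OF t] unfolding M_def A'_eq[OF t] LL[OF t] by simp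
  define V where "V t = matrix_inv (L t) ** (2 *\<^sub>R ?L' t + A t ** L t)" for t
  define W where "W t = matrix_inv (L t) ** (L'' t + A t ** ?L' t + B t ** L t)" for t
  show ?thesis
  proof (rule that[of V W])
    show "C_class 0 t0 V" "C_class 0 t0 W"
      unfolding C_class_0_iff V_def W_def
      by (intro continuous_intros contL contL' contL'' contA contB; simp add: detL0)+
    show "L_equivalent N k t0 (A, B) (V, W)"
      unfolding L_equivalent_def split_conv using Lm
      by (intro exI[of _ L]) (simp add: V_def W_def L'_eq[unfolded One_nat_def] L''_eq)
    show "symmetric_mat (V t) \<and> symmetric_mat (W t)" if "t \<ge> t0" for t
      unfolding V_def W_def symmetric_conjugate_iff[OF detL0[OF that]] using P[OF that] Q[OF that] by blast
  qed
qed

theorem theorem4: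
  fixes N :: "real^'m^'m \<Rightarrow> real" and k :: nat and t0 :: real
    and A B :: "real \<Rightarrow> real^'m^'m"
  assumes "is_matrix_norm N"
    and "k \<in> {0, 1, 2}"
    and "C_class 1 t0 A"
    and "C_class 0 t0 B"
  shows
    "(\<exists>V W. C_class 0 t0 V \<and> C_class 0 t0 W \<and>
        L_equivalent N k t0 (A, B) (V, W) \<and>
        (\<forall>t\<ge>t0. symmetric_mat (V t) \<and> symmetric_mat (W t)))
     \<longleftrightarrow>
     (\<exists>S S0. C_class 1 t0 S \<and> (\<forall>t\<ge>t0. symmetric_mat (S t)) \<and>
        symmetric_mat S0 \<and> pos_definite_mat S0 \<and>
        (let \<Lambda> = (\<lambda>t. 2 *\<^sub>R integral {t0..t} S + S0);
             K = (\<lambda>t. (1/4) *\<^sub>R (\<Lambda> t ** transpose (A t) - A t ** \<Lambda> t));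
             M = (\<lambda>t. (1/2) *\<^sub>R nderiv t0 1 A t + (1/4) *\<^sub>R (A t ** A t) - B t)
         in
           (\<exists>\<mu>>0. \<exists>\<eta>>0. \<forall>t\<ge>t0.
              \<bar>2 * integral {t0..t} (\<lambda>\<nu>. trace (S \<nu>)) + trace S0\<bar> \<le> \<mu>\<^sup>2 \<and>
              det (2 *\<^sub>R integral {t0..t} S + S0) \<ge> \<eta>\<^sup>2) \<and>
           (k \<noteq> 0 \<longrightarrow>
              (\<forall>i\<in>{0..k - 1}. sup_nderiv N t0 i K + sup_nderiv N t0 i S < \<infinity>)) \<and>
           (\<forall>t\<ge>t0. \<Lambda> t ** transpose (M t) = M t ** \<Lambda> t)))"
proof -
  have "k \<le> 2"
    using assms(2) by auto
  \<comment> \<open>The guard \<open>k \<noteq> 0\<close> matters: truncated subtraction makes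
    \<open>{0..k - 1}\<close> equal to \<open>{0}\<close> for \<open>k = 0\<close>, whereas no
    \<open>i < 0\<close> exists.\<close>
  have below: "(k \<noteq> 0 \<longrightarrow> (\<forall>i\<in>{0..k - 1}. Q i)) \<longleftrightarrow> (\<forall>i<k. Q i)" for Q :: "nat \<Rightarrow> bool"
    by (cases k) (auto simp: less_Suc_eq_le)
  let ?\<Lambda> = "\<lambda>S S0 t. 2 *\<^sub>R integral {t0..t} S + S0"
  let ?K = "\<lambda>S S0 t. (1/4) *\<^sub>R (?\<Lambda> S S0 t ** transpose (A t) - A t ** ?\<Lambda> S S0 t)"
  let ?M = "\<lambda>t. (1/2) *\<^sub>R nderiv t0 1 A t + (1/4) *\<^sub>R (A t ** A t) - B t"
  show ?thesis
    unfolding Let_def below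
  proof (intro iffI; elim exE conjE)
    fix V W
    assume "L_equivalent N k t0 (A, B) (V, W)" and sym: "\<forall>t\<ge>t0. symmetric_mat (V t) \<and> symmetric_mat (W t)"
    then obtain L where L: "L_matrix N k t0 L"
      and V: "\<And>t. t \<ge> t0 \<Longrightarrow> V t = matrix_inv (L t) ** (2 *\<^sub>R nderiv t0 1 L t + A t ** L t)"
      and W: "\<And>t. t \<ge> t0 \<Longrightarrow> W t = matrix_inv (L t) ** (nderiv t0 2 L t + A t ** nderiv t0 1 L t + B t ** L t)"
      unfolding L_equivalent_def by auto
    obtain S S0 \<mu> \<eta> where S: "C_class 1 t0 S" and c:
      "\<And>t. t \<ge> t0 \<Longrightarrow> symmetric_mat (S t)" "symmetric_mat S0" "pos_definite_mat S0" "\<mu> > 0" "\<eta> > 0"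
      "\<And>t. t \<ge> t0 \<Longrightarrow> \<bar>trace (?\<Lambda> S S0 t)\<bar> \<le> \<mu>\<^sup>2" "\<And>t. t \<ge> t0 \<Longrightarrow> \<eta>\<^sup>2 \<le> det (?\<Lambda> S S0 t)"
      "\<And>i. i < k \<Longrightarrow> sup_nderiv N t0 i (?K S S0) < \<infinity> \<and> sup_nderiv N t0 i S < \<infinity>"
      "\<And>t. t \<ge> t0 \<Longrightarrow> ?\<Lambda> S S0 t ** transpose (?M t) = ?M t ** ?\<Lambda> S S0 t"
      by (rule symmetrizable_imp_conditions[OF assms(1,3) L \<open>k \<le> 2\<close>, of B])
        (use sym V W in force)+
    have "continuous_on {t0..} S"
      using S by (rule C_class_imp_continuous_on)
    note tr = trace_integral[OF this]
    show "\<exists>S S0. C_class 1 t0 S \<and> (\<forall>t\<ge>t0. symmetric_mat (S t)) \<and>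
        symmetric_mat S0 \<and> pos_definite_mat S0 \<and>
        (\<exists>\<mu>>0. \<exists>\<eta>>0. \<forall>t\<ge>t0.
          \<bar>2 * integral {t0..t} (\<lambda>\<nu>. trace (S \<nu>)) + trace S0\<bar> \<le> \<mu>\<^sup>2 \<and>
          \<eta>\<^sup>2 \<le> det (?\<Lambda> S S0 t)) \<and>
        (\<forall>i<k. sup_nderiv N t0 i (?K S S0) + sup_nderiv N t0 i S < \<infinity>) \<and>
        (\<forall>t\<ge>t0. ?\<Lambda> S S0 t ** transpose (?M t) = ?M t ** ?\<Lambda> S S0 t)"
      unfolding sup_nderiv_add_less_infinity_iff
    proof (intro exI[of _ S] exI[of _ S0] conjI)
      show "\<exists>\<mu>>0. \<exists>\<eta>>0. \<forall>t\<ge>t0.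
          \<bar>2 * integral {t0..t} (\<lambda>\<nu>. trace (S \<nu>)) + trace S0\<bar> \<le> \<mu>\<^sup>2 \<and>
          \<eta>\<^sup>2 \<le> det (?\<Lambda> S S0 t)"
        unfolding tr using c(4-7) by blast
    qed (use S c in simp_all)
  next
    fix S S0 \<mu> \<eta>
    assume S: "C_class 1 t0 S" "\<forall>t\<ge>t0. symmetric_mat (S t)" "symmetric_mat S0" "pos_definite_mat S0" and "\<eta> > 0"
      and bd: "\<forall>t\<ge>t0. \<bar>2 * integral {t0..t} (\<lambda>\<nu>. trace (S \<nu>)) + trace S0\<bar> \<le> \<mu>\<^sup>2 \<and>
          \<eta>\<^sup>2 \<le> det (?\<Lambda> S S0 t)"
      and fin: "\<forall>i<k. sup_nderiv N t0 i (?K S S0) + sup_nderiv N t0 i S < \<infinity>"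
      and M: "\<forall>t\<ge>t0. ?\<Lambda> S S0 t ** transpose (?M t) = ?M t ** ?\<Lambda> S S0 t"
    have "continuous_on {t0..} S"
      using S(1) by (rule C_class_imp_continuous_on)
    note bd = bd[unfolded trace_integral[OF this]]
    obtain V W where "C_class 0 t0 V" "C_class 0 t0 W" "L_equivalent N k t0 (A, B) (V, W)"
      "\<And>t. t \<ge> t0 \<Longrightarrow> symmetric_mat (V t) \<and> symmetric_mat (W t)"
    proof (rule conditions_imp_symmetrizable[OF assms(1,3,4) \<open>k \<le> 2\<close> S(1) _ S(3,4) \<open>\<eta> > 0\<close>, of \<mu>])
      show "sup_nderiv N t0 i (?K S S0) < \<infinity> \<and> sup_nderiv N t0 i S < \<infinity>" if "i < k" for i
        using fin that unfolding sup_nderiv_add_less_infinity_iff by blast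
    qed (use S(2) bd M in blast)+
    then show "\<exists>V W. C_class 0 t0 V \<and> C_class 0 t0 W \<and> L_equivalent N k t0 (A, B) (V, W) \<and>
        (\<forall>t\<ge>t0. symmetric_mat (V t) \<and> symmetric_mat (W t))"
      by blast
  qed
qed

end
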